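(* Let $m,n\ge 1$ and let $k_1,\dots,k_n$ and $l_1,\dots,l_m$ be non-negative integers. Let $\Delta=\Delta^{k_1,\ldots,k_n;l_1,\ldots,l_m}_{m,n}$ be the simplicial complex whose vertices are the cells of a chessboard with $n$ rows and $m$ columns, and whose simplices are the rook placements (sets of cells) having at most $k_i$ rooks in the $i$-th row for each $i\in[n]$ and at most $l_j$ rooks in the $j$-th column for each $j\in[m]$. If \[l_1+l_2+\cdots+l_m\ \ge\ k_1+k_2+\cdots+k_n+n-1,\] then $\Delta$ is $(k_1+k_2+\cdots+k_n-2)$-connected.
   Context: A topological space is $c$-connected if it is nonempty and its homotopy groups $\pi_t$ vanish for all $0\le t\le c$ (with the usual convention that every space is $(-2)$-connected and $(-1)$-connected means nonempty). *)

theory Defs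
  imports "HOL-Analysis.Analysis"
begin

text \<open>Geometric realization of an abstract simplicial complex K (a family of finite
subsets of the finite vertex set V): points are functions V \<rightarrow> R (barycentric
coordinates), nonnegative, summing to 1, whose support is a simplex of K; topology
induced from the product topology on R^V.\<close>
definition geom_realization :: "'v set \<Rightarrow> 'v set set \<Rightarrow> ('v \<Rightarrow> real) topology" where
  "geom_realization V K = subtopology (powertop_real V)
     {f \<in> topspace (powertop_real V). (\<forall>v\<in>V. 0 \<le> f v) \<and> sum f V = 1 \<and> {v\<in>V. f v \<noteq> 0} \<in> K}"

text \<open>c-connected: nonempty and pi_t vanishes for 0 \<le> t \<le> c, expressed as: every
continuous map from the t-sphere is (freely) null-homotopic. Every space is (-2)-connected.\<close>
definition c_connected :: "int \<Rightarrow> 'a topology \<Rightarrow> bool" where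
  "c_connected c X \<longleftrightarrow> c \<le> -2 \<or>
     (topspace X \<noteq> {} \<and>
      (\<forall>t::nat. int t \<le> c \<longrightarrow>
         (\<forall>f. continuous_map (nsphere t) X f \<longrightarrow>
              (\<exists>a. homotopic_with (\<lambda>h. True) (nsphere t) X f (\<lambda>x. a)))))"

text \<open>Chessboard complex with n rows, m columns; cell (i,j) = row i, column j.\<close>
definition board :: "nat \<Rightarrow> nat \<Rightarrow> (nat \<times> nat) set" where
  "board n m = {1..n} \<times> {1..m}"

definition rook_complex :: "nat \<Rightarrow> nat \<Rightarrow> (nat \<Rightarrow> nat) \<Rightarrow> (nat \<Rightarrow> nat) \<Rightarrow> (nat \<times> nat) set set" where
  "rook_complex n m k l = {\<sigma>. \<sigma> \<subseteq> board n m \<and>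
      (\<forall>i\<in>{1..n}. card {j. (i, j) \<in> \<sigma>} \<le> k i) \<and>
      (\<forall>j\<in>{1..m}. card {i. (i, j) \<in> \<sigma>} \<le> l j)}"

end

theory Submission
  imports Defs
begin

text \<open>
  The link of a cell of a chessboard is again a rook complex, with one row and one column capacity
  lowered. Deleting cells in a suitable order builds the complex from a point by elementary
  expansions and by attaching simplices with \<open>k\<^sub>1 + \<dots> + k\<^sub>n\<close> vertices along their boundaries. The
  columns are treated one after the other: a column with \<open>l\<^sub>j \<ge> n\<close> makes the claim true for any
  capacities of the other columns, and otherwise its cells are split off, the inequality between
  the capacities being inherited by all the smaller boards.

  An elementary expansion does not change the homotopy type. Attaching a simplex with more than
  \<open>t + 1\<close> vertices does not destroy the triviality of maps of the \<open>t\<close>-sphere: after a Lipschitz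
  approximation such a map misses an interior point of the simplex, by a pigeonhole argument, and
  can be projected radially from this point into the old complex.
\<close>

section \<open>Complexes built from large simplices\<close>

text \<open>Discrete Morse theory in the form needed here: \<open>K\<close> arises from the void complex by
  elementary expansions and by attaching critical simplices with at least \<open>s\<close> vertices along
  their whole boundary. If \<open>s \<ge> 1\<close>, the first step can only be an expansion by a vertex.\<close>

inductive morse_built :: "nat \<Rightarrow> 'a set set \<Rightarrow> bool" for s where
  void: "morse_built s {}"
| attach: "\<lbrakk>morse_built s K; finite \<sigma>; \<sigma> \<notin> K; \<And>\<rho>. \<rho> \<subset> \<sigma> \<Longrightarrow> \<rho> \<in> K; s \<le> card \<sigma>\<rbrakk>
    \<Longrightarrow> morse_built s (insert \<sigma> K)"
| expand: "\<lbrakk>morse_built s K; finite \<tau>; v \<notin> \<tau>; \<tau> \<notin> K; \<And>\<rho>. \<rho> \<subset> insert v \<tau> \<Longrightarrow> \<rho> \<noteq> \<tau> \<Longrightarrow> \<rho> \<in> K\<rbrakk>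
    \<Longrightarrow> morse_built s (insert \<tau> (insert (insert v \<tau>) K))"

definition down_closed :: "'a set set \<Rightarrow> bool" where
  "down_closed K \<longleftrightarrow> (\<forall>\<sigma>\<in>K. \<forall>\<rho>. \<rho> \<subseteq> \<sigma> \<longrightarrow> \<rho> \<in> K)"

lemma down_closedD: "down_closed K \<Longrightarrow> \<sigma> \<in> K \<Longrightarrow> \<rho> \<subseteq> \<sigma> \<Longrightarrow> \<rho> \<in> K"
  by (auto simp: down_closed_def)

lemma down_closed_remove_maximal:
  assumes "down_closed K" "\<And>\<rho>. \<rho> \<in> K \<Longrightarrow> \<not> \<tau> \<subset> \<rho>"
  shows "down_closed (K - {\<tau>})"
  using assms unfolding down_closed_def by blast

lemma down_closed_morse_built: "morse_built s K \<Longrightarrow> down_closed K"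
proof (induction rule: morse_built.induct)
  case void
  then show ?case by (simp add: down_closed_def)
next
  case (attach K \<sigma>)
  then show ?case unfolding down_closed_def by (metis insert_iff psubsetI)
next
  case (expand K \<tau> v)
  have "\<rho> \<in> insert \<tau> (insert (insert v \<tau>) K)" if "\<rho> \<subseteq> insert v \<tau>" for \<rho>
    using expand.hyps(5)[of \<rho>] that by auto
  then show ?case using expand.IH unfolding down_closed_def by (metis insert_iff subset_insertI2)
qed

text \<open>A cone needs no critical simplex, hence any \<open>s\<close> is allowed: a maximal
  \<tau> of the base is contained in \<open>insert v \<tau>\<close> and in no other larger simplex,
  so the cone over \<open>L\<close> is an expansion of the cone over \<open>L - {\<tau>}\<close>.
  For nonempty \<open>L\<close> the first pair is \<open>{}\<close> and \<open>{v}\<close>.\<close>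

lemma morse_built_cone:
  assumes "finite L" "\<And>\<tau>. \<tau> \<in> L \<Longrightarrow> finite \<tau> \<and> v \<notin> \<tau>" "down_closed L"
  shows "morse_built s (L \<union> insert v ` L)"
  using assms
proof (induction "card L" arbitrary: L)
  case 0
  then show ?case by (simp add: morse_built.void)
next
  case (Suc n)
  then obtain \<tau> where \<tau>: "\<tau> \<in> L" "\<And>\<rho>. \<rho> \<in> L \<Longrightarrow> \<not> \<tau> \<subset> \<rho>"
    using finite_has_maximal[of L] by fastforce
  define L' where "L' = L - {\<tau>}"
  have "down_closed L'" unfolding L'_def using Suc.prems \<tau> by (intro down_closed_remove_maximal) auto
  then have "morse_built s (L' \<union> insert v ` L')"
    using Suc.prems Suc.hyps(2) \<tau> by (intro Suc.hyps(1)) (auto simp: L'_def)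
  moreover have "\<tau> \<notin> L' \<union> insert v ` L'" using Suc \<tau> by (auto simp: L'_def)
  moreover have "\<rho> \<in> L' \<union> insert v ` L'" if "\<rho> \<subset> insert v \<tau>" "\<rho> \<noteq> \<tau>" for \<rho>
  proof (cases "v \<in> \<rho>")
    case True
    have "\<rho> - {v} \<subset> \<tau>" using that True by auto
    then have "\<rho> - {v} \<in> L'" using \<tau> Suc.prems(3) by (auto simp: L'_def down_closed_def)
    moreover have "\<rho> = insert v (\<rho> - {v})" using True by auto
    ultimately show ?thesis by blast
  next
    case False
    then have "\<rho> \<subseteq> \<tau>" using that by auto
    then show ?thesis using down_closedD[OF Suc.prems(3) \<tau>(1)] that by (simp add: L'_def)
  qed
  ultimately have "morse_built s (insert \<tau> (insert (insert v \<tau>) (L' \<union> insert v ` L')))"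
    using Suc.prems \<tau> by (intro morse_built.expand) auto
  moreover have "insert \<tau> (insert (insert v \<tau>) (L' \<union> insert v ` L')) = L \<union> insert v ` L"
    using \<tau> by (auto simp: L'_def)
  ultimately show ?case by simp
qed

text \<open>For \<open>s = 0\<close> every simplex may be critical, even the empty one. This settles
  boards on which no rook is demanded.\<close>

lemma morse_built_0:
  assumes "finite K" "\<And>\<sigma>. \<sigma> \<in> K \<Longrightarrow> finite \<sigma>" "down_closed K"
  shows "morse_built 0 K"
  using assms
proof (induction "card K" arbitrary: K)
  case 0
  then show ?case by (simp add: morse_built.void)
next
  case (Suc n)
  then obtain \<tau> where \<tau>: "\<tau> \<in> K" "\<And>\<rho>. \<rho> \<in> K \<Longrightarrow> \<not> \<tau> \<subset> \<rho>"
    using finite_has_maximal[of K] by fastforce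
  have "down_closed (K - {\<tau>})" using Suc.prems \<tau> by (intro down_closed_remove_maximal) auto
  then have "morse_built 0 (K - {\<tau>})"
    using Suc.prems Suc.hyps(2) \<tau> by (intro Suc.hyps(1)) auto
  then have "morse_built 0 (insert \<tau> (K - {\<tau>}))"
    using Suc.prems \<tau> by (intro morse_built.attach) (auto simp: down_closed_def)
  then show ?case using \<tau> by (simp add: insert_absorb)
qed

text \<open>The steps that build the link \<open>L\<close> are repeated on top of the deletion
  \<open>D\<close>, with \<open>v\<close> added to every simplex; faces avoiding \<open>v\<close>
  are already present because \<open>L \<subseteq> D\<close>. A critical simplex gains one vertex in
  this way, so the link may have a bound smaller by one.\<close>

lemma morse_built_vertex:
  assumes "morse_built s' L" "morse_built s D" "\<And>\<sigma>. \<sigma> \<in> D \<Longrightarrow> v \<notin> \<sigma>" "L \<subseteq> D" "s \<le> Suc s'"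
  shows "morse_built s (D \<union> insert v ` L)"
  using assms(1,4)
proof (induction rule: morse_built.induct)
  case void
  then show ?case using assms by simp
next
  case (attach K \<sigma>)
  have "\<rho> \<in> D \<union> insert v ` K" if "\<rho> \<subset> insert v \<sigma>" for \<rho>
  proof (cases "v \<in> \<rho>")
    case True
    then have "\<rho> - {v} \<subset> \<sigma>" "\<rho> = insert v (\<rho> - {v})" using that by auto
    then show ?thesis using attach.hyps(4)[of "\<rho> - {v}"] by blast
  next
    case False
    then have "\<rho> \<subseteq> \<sigma>" using that by auto
    then show ?thesis using attach.prems down_closedD[OF down_closed_morse_built[OF assms(2)]]
      by (metis UnI1 insertCI subsetD)
  qed
  moreover have v: "v \<notin> \<sigma>" "\<And>\<rho>. \<rho> \<in> K \<Longrightarrow> v \<notin> \<rho>" using assms(3) attach.prems by auto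
  moreover have "insert v \<sigma> \<notin> D \<union> insert v ` K"
    using v attach.hyps assms(3) by (auto simp: insert_ident)
  ultimately have "morse_built s (insert (insert v \<sigma>) (D \<union> insert v ` K))"
    using attach assms(5) by (intro morse_built.attach) auto
  then show ?case by simp
next
  case (expand K \<tau> w)
  have v: "v \<notin> insert w \<tau>" "\<And>\<rho>. \<rho> \<in> K \<Longrightarrow> v \<notin> \<rho>" using assms(3) expand.prems by auto
  have "\<rho> \<in> D \<union> insert v ` K" if "\<rho> \<subset> insert w (insert v \<tau>)" "\<rho> \<noteq> insert v \<tau>" for \<rho>
  proof (cases "v \<in> \<rho>")
    case True
    then have "\<rho> - {v} \<subset> insert w \<tau>" "\<rho> = insert v (\<rho> - {v})" "\<rho> - {v} \<noteq> \<tau>"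
      using that v by auto
    then show ?thesis using expand.hyps(5)[of "\<rho> - {v}"] by blast
  next
    case False
    then have "\<rho> \<subseteq> insert w \<tau>" using that by auto
    then show ?thesis using expand.prems down_closedD[OF down_closed_morse_built[OF assms(2)]]
      by (metis UnI1 insertCI subsetD)
  qed
  moreover have "insert v \<tau> \<notin> D" using assms(3) by blast
  moreover have "insert v \<tau> \<notin> insert v ` K"
    using v expand.hyps(4) by (auto simp: insert_ident)
  ultimately have "morse_built s (insert (insert v \<tau>) (insert (insert w (insert v \<tau>)) (D \<union> insert v ` K)))"
    using expand v by (intro morse_built.expand) auto
  then show ?case by (simp add: insert_commute)
qed

section \<open>Rook placements on general boards\<close>

text \<open>The cells form an arbitrary set, since splitting off cells leaves boards that are not
  rectangles. The bounds range over all indices, so that \<open>B\<close> can shrink while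
  \<open>k\<close> and \<open>l\<close> stay.\<close>

definition rooks :: "('r \<times> 'c) set \<Rightarrow> ('r \<Rightarrow> nat) \<Rightarrow> ('c \<Rightarrow> nat) \<Rightarrow> ('r \<times> 'c) set set" where
  "rooks B k l = {\<sigma>. \<sigma> \<subseteq> B \<and> (\<forall>i. card {j. (i, j) \<in> \<sigma>} \<le> k i) \<and> (\<forall>j. card {i. (i, j) \<in> \<sigma>} \<le> l j)}"

lemma finite_row: "finite B \<Longrightarrow> finite {j. (i, j) \<in> B}"
  by (rule finite_subset[of _ "snd ` B"]) force+

lemma finite_column: "finite B \<Longrightarrow> finite {i. (i, j) \<in> B}"
  by (rule finite_subset[of _ "fst ` B"]) force+

lemma down_closed_rooks: assumes "finite B" shows "down_closed (rooks B k l)"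
  unfolding down_closed_def
proof (intro ballI allI impI)
  fix \<sigma> \<rho> assume \<sigma>: "\<sigma> \<in> rooks B k l" "\<rho> \<subseteq> \<sigma>"
  then have "finite \<sigma>" using assms finite_subset by (auto simp: rooks_def)
  then have "card {j. (i, j) \<in> \<rho>} \<le> card {j. (i, j) \<in> \<sigma>}"
       "card {i. (i, j) \<in> \<rho>} \<le> card {i. (i, j) \<in> \<sigma>}" for i j
    using \<sigma>(2) by (auto intro!: card_mono finite_row finite_column)
  then show "\<rho> \<in> rooks B k l" using \<sigma> unfolding rooks_def by (blast intro: le_trans)
qed

lemma finite_rooks: "finite B \<Longrightarrow> finite (rooks B k l)"
  by (rule finite_subset[of _ "Pow B"]) (auto simp: rooks_def)

lemma finite_rook_placement: "finite B \<Longrightarrow> \<sigma> \<in> rooks B k l \<Longrightarrow> finite \<sigma>"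
  by (auto simp: rooks_def finite_subset)

lemma morse_built_rooks_0: "finite B \<Longrightarrow> morse_built 0 (rooks B k l)"
  by (intro morse_built_0 finite_rooks down_closed_rooks) (auto intro: finite_rook_placement)

text \<open>Serves to undo or to lower a capacity that cannot be exceeded anyway: at a cone apex, in
  a deleted row, in a column with as much capacity as cells.\<close>

lemma rooks_cong:
  assumes "finite B"
    and "\<And>i. k i = k' i \<or> card {j. (i, j) \<in> B} \<le> min (k i) (k' i)"
    and "\<And>j. l j = l' j \<or> card {i. (i, j) \<in> B} \<le> min (l j) (l' j)"
  shows "rooks B k l = rooks B k' l'"
proof -
  have "(card {j. (i, j) \<in> \<sigma>} \<le> k i) = (card {j. (i, j) \<in> \<sigma>} \<le> k' i)"
       "(card {i. (i, j) \<in> \<sigma>} \<le> l j) = (card {i. (i, j) \<in> \<sigma>} \<le> l' j)" if "\<sigma> \<subseteq> B" for \<sigma> i j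
  proof -
    have "card {j. (i, j) \<in> \<sigma>} \<le> card {j. (i, j) \<in> B}" "card {i. (i, j) \<in> \<sigma>} \<le> card {i. (i, j) \<in> B}"
      using that assms(1) by (auto intro!: card_mono finite_row finite_column)
    then show "(card {j. (i, j) \<in> \<sigma>} \<le> k i) = (card {j. (i, j) \<in> \<sigma>} \<le> k' i)"
       "(card {i. (i, j) \<in> \<sigma>} \<le> l j) = (card {i. (i, j) \<in> \<sigma>} \<le> l' j)"
      using assms(2)[of i] assms(3)[of j] by auto
  qed
  then show ?thesis unfolding rooks_def by blast
qed

section \<open>Link and deletion of a cell\<close>

lemma insert_cell_mem_rooks_iff:
  assumes "finite B" "(i, j) \<in> B" "\<sigma> \<subseteq> B - {(i, j)}"
  shows "insert (i, j) \<sigma> \<in> rooks B k l \<longleftrightarrow>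
    k i > 0 \<and> l j > 0 \<and> \<sigma> \<in> rooks (B - {(i, j)}) (k(i := k i - 1)) (l(j := l j - 1))"
proof -
  have fin: "finite \<sigma>" using assms finite_subset by blast
  have "{j'. (i, j') \<in> insert (i, j) \<sigma>} = insert j {j'. (i, j') \<in> \<sigma>}"
    "{i'. (i', j) \<in> insert (i, j) \<sigma>} = insert i {i'. (i', j) \<in> \<sigma>}"
    "j \<notin> {j'. (i, j') \<in> \<sigma>}" "i \<notin> {i'. (i', j) \<in> \<sigma>}" using assms(3) by auto
  then have c: "card {j'. (i, j') \<in> insert (i, j) \<sigma>} = Suc (card {j'. (i, j') \<in> \<sigma>})"
    "card {i'. (i', j) \<in> insert (i, j) \<sigma>} = Suc (card {i'. (i', j) \<in> \<sigma>})"
    using finite_row[OF fin] finite_column[OF fin] by simp_all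
  have "(card {j'. (i', j') \<in> insert (i, j) \<sigma>} \<le> k i') \<longleftrightarrow>
      (i' = i \<longrightarrow> k i > 0) \<and> card {j'. (i', j') \<in> \<sigma>} \<le> (k(i := k i - 1)) i'" for i'
    by (cases "i' = i") (auto simp: c simp del: insert_iff, auto)
  then have "(\<forall>i'. card {j'. (i', j') \<in> insert (i, j) \<sigma>} \<le> k i') \<longleftrightarrow>
      k i > 0 \<and> (\<forall>i'. card {j'. (i', j') \<in> \<sigma>} \<le> (k(i := k i - 1)) i')" by blast
  moreover have "(card {i'. (i', j') \<in> insert (i, j) \<sigma>} \<le> l j') \<longleftrightarrow>
      (j' = j \<longrightarrow> l j > 0) \<and> card {i'. (i', j') \<in> \<sigma>} \<le> (l(j := l j - 1)) j'" for j'
    by (cases "j' = j") (auto simp: c simp del: insert_iff, auto)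
  then have "(\<forall>j'. card {i'. (i', j') \<in> insert (i, j) \<sigma>} \<le> l j') \<longleftrightarrow>
      l j > 0 \<and> (\<forall>j'. card {i'. (i', j') \<in> \<sigma>} \<le> (l(j := l j - 1)) j')" by blast
  ultimately show ?thesis using assms unfolding rooks_def by blast
qed

text \<open>The cases are separated because natural subtraction would leave an exhausted capacity at
  0. The second branch is the void complex and not \<open>{{}}\<close>: a cell that admits no rook
  is not even a vertex.\<close>

lemma rooks_vertex_split:
  assumes "finite B" "(i, j) \<in> B"
  shows "rooks B k l = rooks (B - {(i, j)}) k l \<union> insert (i, j) `
    (if k i > 0 \<and> l j > 0 then rooks (B - {(i, j)}) (k(i := k i - 1)) (l(j := l j - 1)) else {})"
    (is "_ = ?D \<union> insert _ ` ?L")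
proof (rule set_eqI)
  fix \<sigma>
  have L: "\<rho> \<subseteq> B - {(i, j)}" if "\<rho> \<in> ?L" for \<rho>
    using that by (auto simp: rooks_def split: if_splits)
  show "\<sigma> \<in> rooks B k l \<longleftrightarrow> \<sigma> \<in> ?D \<union> insert (i, j) ` ?L"
  proof (cases "(i, j) \<in> \<sigma>")
    case True
    then have eq: "\<sigma> = insert (i, j) (\<sigma> - {(i, j)})" by auto
    have "\<sigma> \<notin> ?D" using True by (auto simp: rooks_def)
    moreover have "\<sigma> \<in> insert (i, j) ` ?L \<longleftrightarrow> \<sigma> - {(i, j)} \<in> ?L"
    proof
      assume "\<sigma> \<in> insert (i, j) ` ?L"
      then obtain \<rho> where "\<rho> \<in> ?L" "\<sigma> = insert (i, j) \<rho>" by blast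
      with L[of \<rho>] show "\<sigma> - {(i, j)} \<in> ?L" by (metis Diff_insert_absorb subset_Diff_insert)
    next
      assume "\<sigma> - {(i, j)} \<in> ?L"
      then show "\<sigma> \<in> insert (i, j) ` ?L" using eq by blast
    qed
    moreover have "\<sigma> \<in> rooks B k l \<longleftrightarrow> \<sigma> - {(i, j)} \<in> ?L"
    proof (cases "\<sigma> \<subseteq> B")
      case True
      then have "\<sigma> - {(i, j)} \<subseteq> B - {(i, j)}" by auto
      then show ?thesis using insert_cell_mem_rooks_iff[OF assms, of "\<sigma> - {(i, j)}" k l] eq by auto
    next
      case False
      then have "\<not> \<sigma> - {(i, j)} \<subseteq> B - {(i, j)}" using assms(2) by auto
      then show ?thesis using L[of "\<sigma> - {(i, j)}"] False unfolding rooks_def by blast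
    qed
    ultimately show ?thesis by blast
  next
    case False
    then have "\<sigma> \<notin> insert (i, j) ` ?L" by auto
    moreover have "\<sigma> \<in> rooks B k l \<longleftrightarrow> \<sigma> \<in> ?D" using False unfolding rooks_def by blast
    ultimately show ?thesis by blast
  qed
qed

lemma rooks_link_subset:
  assumes "finite B"
  shows "rooks B (k(i := k i - 1)) (l(j := l j - 1)) \<subseteq> rooks B k l"
proof
  fix \<sigma> assume "\<sigma> \<in> rooks B (k(i := k i - 1)) (l(j := l j - 1))"
  moreover have "(k(i := k i - 1)) i' \<le> k i'" "(l(j := l j - 1)) j' \<le> l j'" for i' j' by auto
  ultimately show "\<sigma> \<in> rooks B k l" unfolding rooks_def by (blast intro: le_trans)
qed

lemma morse_built_rooks_vertex:
  assumes "finite B" "(i, j) \<in> B" "morse_built s (rooks (B - {(i, j)}) k l)"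
    and "k i > 0 \<Longrightarrow> l j > 0 \<Longrightarrow>
      morse_built (s - 1) (rooks (B - {(i, j)}) (k(i := k i - 1)) (l(j := l j - 1)))"
  shows "morse_built s (rooks B k l)"
  unfolding rooks_vertex_split[OF assms(1,2)]
\<comment> \<open>For \<open>s = 0\<close> the subtraction gives \<open>s' = 0\<close>, and
  \<open>s \<le> Suc s'\<close> still holds.\<close>
proof (rule morse_built_vertex[where s' = "s - 1"])
  show "morse_built s (rooks (B - {(i, j)}) k l)" by fact
  show "morse_built (s - 1) (if k i > 0 \<and> l j > 0 then rooks (B - {(i, j)}) (k(i := k i - 1)) (l(j := l j - 1)) else {})"
    using assms(4) by (auto intro: morse_built.void)
qed (use assms rooks_link_subset[of "B - {(i, j)}" k i l j] in \<open>auto simp: rooks_def\<close>)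

text \<open>A rook on \<open>(r, c)\<close> can be added to any placement without violating a bound.
  The link of this cell therefore equals its deletion, and the complex is a cone.\<close>

lemma morse_built_rooks_cone:
  assumes "finite B" "(r, c) \<in> B" "card {i. (i, c) \<in> B} \<le> l c" "card {j. (r, j) \<in> B} \<le> k r"
  shows "morse_built s (rooks B k l)"
proof -
  let ?B = "B - {(r, c)}"
  have "{i. (i, c) \<in> B} = insert r {i. (i, c) \<in> ?B}" "{j. (r, j) \<in> B} = insert c {j. (r, j) \<in> ?B}"
    using assms(2) by auto
  then have *: "Suc (card {i. (i, c) \<in> ?B}) \<le> l c" "Suc (card {j. (r, j) \<in> ?B}) \<le> k r"
    using assms finite_row[of ?B r] finite_column[of ?B c] by auto
  then have "rooks ?B (k(r := k r - 1)) (l(c := l c - 1)) = rooks ?B k l"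
    using assms(1) by (intro rooks_cong) auto
  then have "rooks B k l = rooks ?B k l \<union> insert (r, c) ` rooks ?B k l"
    using rooks_vertex_split[OF assms(1,2), of k l] * by auto
  moreover have "morse_built s (rooks ?B k l \<union> insert (r, c) ` rooks ?B k l)"
    using assms(1)
    by (intro morse_built_cone finite_rooks down_closed_rooks)
      (auto intro: finite_rook_placement[of ?B], auto simp: rooks_def)
  ultimately show ?thesis by simp
qed

text \<open>If column \<open>c\<close> imposes no restriction, the cells of row \<open>r\<close> other than \<open>(r, c)\<close> can be split off
  one by one. Either \<open>(r, c)\<close> is left alone in its row and is a cone apex, or all \<open>k r\<close> rooks of the
  row have been placed.\<close>

lemma morse_built_rooks_row:
  assumes "finite B" "(r, c) \<in> B" "card {i. (i, c) \<in> B} \<le> l c" "finite J" "snd ` B \<subseteq> J"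
    and "\<And>l'. l' c = l c \<Longrightarrow> sum l' J + k r = sum l J \<Longrightarrow> morse_built s (rooks (B - {r} \<times> UNIV) k l')"
  shows "morse_built (s + k r) (rooks B k l)"
  using assms
proof (induction "card B" arbitrary: B k l)
  case 0
  then show ?case by auto
next
  case (Suc n)
  consider "k r = 0" | "k r > 0" "card {j. (r, j) \<in> B} \<le> 1" | j where "k r > 0" "(r, j) \<in> B" "j \<noteq> c"
  proof -
    have "card {j. (r, j) \<in> B} \<le> 1" if "\<not> (\<exists>j. (r, j) \<in> B \<and> j \<noteq> c)"
    proof -
      have "{j. (r, j) \<in> B} \<subseteq> {c}" using that by auto
      then show ?thesis using card_mono[of "{c}"] by fastforce
    qed
    then show ?thesis using that by blast
  qed
  then show ?case
  proof cases
    case 1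
    have "rooks B k l = rooks (B - {r} \<times> UNIV) k l"
    proof -
      have "\<sigma> \<subseteq> B - {r} \<times> UNIV" if "\<sigma> \<subseteq> B" "card {j. (r, j) \<in> \<sigma>} \<le> k r" for \<sigma>
      proof -
        have "finite \<sigma>" using that Suc.prems(1) finite_subset by blast
        then have "{j. (r, j) \<in> \<sigma>} = {}" using that 1 finite_row[of \<sigma> r] by auto
        then show ?thesis using that by auto
      qed
      then show ?thesis by (auto simp: rooks_def)
    qed
    then show ?thesis using Suc.prems(6)[of l] 1 by simp
  next
    case 2
    then show ?thesis using Suc.prems by (intro morse_built_rooks_cone[of B r c]) auto
  next
    case 3
    let ?B = "B - {(r, j)}"
    have n: "n = card ?B" using Suc 3 by simp
    have B: "?B - {r} \<times> UNIV = B - {r} \<times> UNIV" by auto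
    have col: "card {i. (i, c) \<in> ?B} \<le> l c"
      using Suc.prems(3) 3 by auto
    show ?thesis
    proof (rule morse_built_rooks_vertex[OF Suc.prems(1) 3(2)])
      show "morse_built (s + k r) (rooks ?B k l)"
        using Suc.prems 3 col by (intro Suc.hyps(1)[OF n]) (auto simp: B)
      assume l: "l j > 0"
      let ?k = "k(r := k r - 1)" and ?l = "l(j := l j - 1)"
      have jJ: "j \<in> J" using Suc.prems(5) 3 by force
      have "morse_built (s + ?k r) (rooks ?B ?k ?l)"
      proof (rule Suc.hyps(1)[OF n])
        \<comment> \<open>The unit taken from \<open>l j\<close> and the unit taken from
          \<open>k r\<close> cancel in the balance, so \<open>l'\<close> is also admissible for the
          assumption about the original capacities.\<close>
        fix l' assume l': "l' c = ?l c" "sum l' J + ?k r = sum ?l J"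
        have "sum l J = l j + sum l (J - {j})" "sum ?l J = (l j - 1) + sum l (J - {j})"
          using sum.remove[OF Suc.prems(4) jJ, of l] sum.remove[OF Suc.prems(4) jJ, of ?l]
          by (auto intro: sum.cong)
        then have "morse_built s (rooks (B - {r} \<times> UNIV) k l')"
          using l' 3 l by (intro Suc.prems(6)) auto
        moreover have "rooks (B - {r} \<times> UNIV) k l' = rooks (B - {r} \<times> UNIV) ?k l'"
          using Suc.prems(1) by (intro rooks_cong) auto
        ultimately show "morse_built s (rooks (?B - {r} \<times> UNIV) ?k l')" by (simp add: B)
      qed (use Suc.prems 3 col in auto)
      then show "morse_built (s + k r - 1) (rooks ?B ?k ?l)" using 3 by simp
    qed
  qed
qed

text \<open>Column \<open>c\<close> alone offers a cone apex in each row, and emptying a row leaves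
  \<open>l c\<close> untouched. The induction over the rows thus works for every choice of the other
  capacities.\<close>

lemma morse_built_rooks_free_column:
  assumes "finite I" "finite J" "c \<in> J" "card I \<le> l c"
  shows "morse_built (sum k I) (rooks (I \<times> J) k l)"
  using assms
proof (induction I arbitrary: l rule: finite_induct)
  case empty
  then show ?case using morse_built_rooks_0[of "{} \<times> J"] by simp
next
  case (insert r I)
  have "morse_built (sum k I + k r) (rooks (insert r I \<times> J) k l)"
  proof (rule morse_built_rooks_row[where c = c and J = J])
    fix l' assume "l' c = l c"
    then have "morse_built (sum k I) (rooks (I \<times> J) k l')"
      using insert by simp
    moreover have "insert r I \<times> J - {r} \<times> UNIV = I \<times> J" using insert by auto
    ultimately show "morse_built (sum k I) (rooks (insert r I \<times> J - {r} \<times> UNIV) k l')" by simp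
  next
    have "{i. (i, c) \<in> insert r I \<times> J} = insert r I" using insert by auto
    then show "card {i. (i, c) \<in> insert r I \<times> J} \<le> l c" using insert by simp
  qed (use insert in auto)
  then show ?case using insert by (simp add: add.commute)
qed

text \<open>The cells of the incomplete column \<open>c\<close>, occupying the rows \<open>R\<close>, are split off until the capacity
  \<open>l c\<close> is either used up or no longer a restriction. In the latter case removing a row of \<open>R\<close>
  lowers the required column capacity by one more than the rooks in that row use, which pays for
  lowering \<open>l c\<close>, now superfluous by one.\<close>

lemma morse_built_rooks_short_column:
  fixes I R :: "'r set" and J :: "'c set"
  assumes IH: "\<And>I k l. finite I \<Longrightarrow> sum k I + card I \<le> sum l J + 1 \<Longrightarrow>
      morse_built (sum k I) (rooks (I \<times> J) (k :: 'r \<Rightarrow> nat) (l :: 'c \<Rightarrow> nat))"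
    and "finite J" "c \<notin> J" "finite I" "R \<subseteq> I" "l c \<le> card R"
    and "sum k I + card I \<le> sum l J + l c + 1"
  shows "morse_built (sum k I) (rooks (I \<times> J \<union> R \<times> {c}) k l)"
  using assms(4-)
proof (induction "card R" arbitrary: R I k l rule: less_induct)
  case less
  have fin: "finite R" "finite (I \<times> J \<union> R \<times> {c})"
    using less.prems assms(2) finite_subset by blast+
  consider "l c = 0" | "0 < l c" "l c < card R" | "0 < l c" "l c = card R"
    using less.prems by linarith
  then show ?case
  proof cases
    case 1
    have "rooks (I \<times> J \<union> R \<times> {c}) k l = rooks (I \<times> J) k l"
    proof -
      have "\<sigma> \<subseteq> I \<times> J" if "\<sigma> \<subseteq> I \<times> J \<union> R \<times> {c}" "card {i. (i, c) \<in> \<sigma>} \<le> l c" for \<sigma>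
      proof -
        have "finite \<sigma>" using that fin(2) finite_subset by blast
        then have "{i. (i, c) \<in> \<sigma>} = {}" using that 1 finite_column[of \<sigma> c] by auto
        then show ?thesis using that by auto
      qed
      then show ?thesis by (auto simp: rooks_def)
    qed
    then show ?thesis using IH[of I k l] 1 less.prems by simp
  next
    \<comment> \<open>Strictness keeps \<open>l c \<le> card R - 1\<close> in the deletion. In the
      link both sides of the inequality drop by one.\<close>
    case 2
    then obtain i where i: "i \<in> R" by fastforce
    have B: "I \<times> J \<union> R \<times> {c} - {(i, c)} = I \<times> J \<union> (R - {i}) \<times> {c}"
      using assms(3) by auto
    have card: "card (R - {i}) < card R" "card (R - {i}) = card R - 1" using 2 i fin by auto
    show ?thesis
    proof (rule morse_built_rooks_vertex[of _ i c], unfold B)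
      show "morse_built (sum k I) (rooks (I \<times> J \<union> (R - {i}) \<times> {c}) k l)"
        using less.prems 2 card by (intro less.hyps) auto
      assume k: "0 < k i"
      let ?k = "k(i := k i - 1)" and ?l = "l(c := l c - 1)"
      have "i \<in> I" using i less.prems by auto
      then have "sum k I = k i + sum k (I - {i})" "sum ?k I = (k i - 1) + sum k (I - {i})"
        using sum.remove[OF less.prems(1), of i k] sum.remove[OF less.prems(1), of i ?k]
        by (auto intro: sum.cong)
      then have sk: "sum ?k I = sum k I - 1" "sum k I > 0" using k by auto
      have "sum ?l J = sum l J" using assms(3) by (intro sum.cong) auto
      then have "morse_built (sum ?k I) (rooks (I \<times> J \<union> (R - {i}) \<times> {c}) ?k ?l)"
        using less.prems 2 card sk by (intro less.hyps) auto
      then show "morse_built (sum k I - 1) (rooks (I \<times> J \<union> (R - {i}) \<times> {c}) ?k ?l)"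
        by (simp only: sk)
    qed (use i fin in auto)
  next
    case 3
    then obtain r where r: "r \<in> R" by fastforce
    then have rI: "r \<in> I" using less.prems by auto
    have col: "{i. (i, c) \<in> I \<times> J \<union> R \<times> {c}} = R" using assms(3) by auto
    have card: "card (R - {r}) < card R" "card (R - {r}) = card R - 1" using 3 r fin by auto
    have "morse_built (sum k (I - {r}) + k r) (rooks (I \<times> J \<union> R \<times> {c}) k l)"
    proof (rule morse_built_rooks_row[where c = c and J = "insert c J"])
      fix l' assume l': "l' c = l c" "sum l' (insert c J) + k r = sum l (insert c J)"
      \<comment> \<open>Without \<open>r\<close> the column has only \<open>l c - 1\<close> cells.
        Lowering its capacity to this number leaves the complex unchanged and restores the bound by
        the number of cells that the induction hypothesis asks for.\<close>
      let ?l = "l'(c := l c - 1)"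
      have B: "I \<times> J \<union> R \<times> {c} - {r} \<times> UNIV = (I - {r}) \<times> J \<union> (R - {r}) \<times> {c}" by auto
      have sl: "sum ?l J = sum l' J" using assms(3) by (intro sum.cong) auto
      have "sum k I = k r + sum k (I - {r})" "card I = Suc (card (I - {r}))"
        using sum.remove[of I r k] card.remove[of I r] less.prems(1) rI by simp_all
      moreover have "sum l' J + k r = sum l J" using l' assms(2,3) by simp
      ultimately have "sum k (I - {r}) + card (I - {r}) \<le> sum ?l J + ?l c + 1"
        unfolding sl using less.prems(4) 3 by simp
      then have "morse_built (sum k (I - {r})) (rooks ((I - {r}) \<times> J \<union> (R - {r}) \<times> {c}) k ?l)"
        using less.prems(1,2) 3 card by (intro less.hyps) auto
      moreover have "rooks ((I - {r}) \<times> J \<union> (R - {r}) \<times> {c}) k ?l = rooks ((I - {r}) \<times> J \<union> (R - {r}) \<times> {c}) k l'"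
      proof (rule rooks_cong)
        have "{i. (i, c) \<in> (I - {r}) \<times> J \<union> (R - {r}) \<times> {c}} = R - {r}" using assms(3) by auto
        then show "?l j = l' j \<or> card {i. (i, j) \<in> (I - {r}) \<times> J \<union> (R - {r}) \<times> {c}} \<le> min (?l j) (l' j)" for j
          using card 3 l' by auto
      qed (use less.prems assms(2) fin in auto)
      ultimately show "morse_built (sum k (I - {r})) (rooks (I \<times> J \<union> R \<times> {c} - {r} \<times> UNIV) k l')"
        by (simp add: B)
    qed (use r fin assms(2) col 3 in auto)
    moreover have "sum k (I - {r}) + k r = sum k I" using less.prems rI by (simp add: sum.remove)
    ultimately show ?thesis by simp
  qed
qed

text \<open>Induction over the columns, with rows and capacities arbitrary because treating a column
  changes them. The \<open>1\<close> stands on the right since rows may run out, where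
  \<open>card I - 1\<close> would be truncated.\<close>

lemma morse_built_rooks:
  assumes "finite J" "finite I" "sum k I + card I \<le> sum l J + 1"
  shows "morse_built (sum k I) (rooks (I \<times> J) k l)"
  using assms
proof (induction J arbitrary: I k l rule: finite_induct)
  case empty
  have "sum k I = 0"
  proof (cases "I = {}")
    case False
    then have "card I > 0" using empty by (simp add: card_gt_0_iff)
    then have "sum k I \<le> 0" using empty(2) by simp
    then show ?thesis by (simp only: le_zero_eq)
  qed simp
  then show ?case using empty morse_built_rooks_0[of "I \<times> {}"] by simp
next
  case (insert c J)
  show ?case
  proof (cases "card I \<le> l c")
    case True
    then show ?thesis using insert by (intro morse_built_rooks_free_column[where c = c]) auto
  next
    case False
    have "morse_built (sum k I) (rooks (I \<times> J \<union> I \<times> {c}) k l)"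
      using insert False by (intro morse_built_rooks_short_column) auto
    moreover have "I \<times> J \<union> I \<times> {c} = I \<times> insert c J" by auto
    ultimately show ?thesis by simp
  qed
qed

section \<open>Lipschitz maps on spheres\<close>

lemma topspace_nsphere:
  "topspace (nsphere t) = {x. (\<Sum>i\<le>t. (x i)\<^sup>2) = 1 \<and> (\<forall>i>t. x i = 0)}"
  by (auto simp: nsphere)

lemma abs_le_1_nsphere:
  assumes "x \<in> topspace (nsphere t)"
  shows "\<bar>x i\<bar> \<le> 1"
proof (cases "i \<le> t")
  case True
  then have "(x i)\<^sup>2 \<le> (\<Sum>i\<le>t. (x i)\<^sup>2)" by (intro member_le_sum) auto
  then show ?thesis using assms by (simp add: topspace_nsphere abs_square_le_1)
next
  case False
  then show ?thesis using assms by (simp add: topspace_nsphere)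
qed

text \<open>The sphere lies in a space of sequences, so boundedness is not enough: it is a closed
  subset of an infinite cube, which is compact by Tychonoff.\<close>

lemma compact_nsphere: "compact (topspace (nsphere t))"
proof -
  have "closed {x :: nat \<Rightarrow> real. (\<Sum>i\<le>t. (x i)\<^sup>2) = 1 \<and> (\<forall>i>t. x i = 0)}"
    by (intro closed_Collect_conj closed_Collect_all closed_Collect_imp closed_Collect_eq open_Collect_const
        continuous_intros continuous_on_product_coordinates)
  then have cl: "closedin (powertop_real UNIV) (topspace (nsphere t))"
    by (simp add: topspace_nsphere euclidean_product_topology)
  have "compactin (powertop_real UNIV) (PiE UNIV (\<lambda>i::nat. {-1..1::real}))"
    by (simp add: compactin_PiE)
  moreover have "topspace (nsphere t) \<subseteq> PiE UNIV (\<lambda>i::nat. {-1..1::real})"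
    using abs_le_1_nsphere by (fastforce simp: abs_le_iff)
  ultimately have "compactin (powertop_real UNIV) (topspace (nsphere t))"
    using cl closed_compactin by blast
  then show ?thesis by (simp add: euclidean_product_topology compactin_euclidean_iff)
qed

text \<open>A box of side 1/M in the t coordinates other than a coordinate of modulus at least
  1/(t+1) controls the remaining coordinate as well, so the sphere has box dimension at most t.\<close>

lemma nsphere_cover:
  fixes t M :: nat
  assumes "M \<ge> 1"
  obtains c :: "(nat \<Rightarrow> real) \<Rightarrow> nat \<times> bool \<times> (nat \<Rightarrow> int)" and C where
    "finite C" "card C \<le> 2 * (t + 1) * (3 * M) ^ t" "c ` topspace (nsphere t) \<subseteq> C"
    "\<And>x y. x \<in> topspace (nsphere t) \<Longrightarrow> y \<in> topspace (nsphere t) \<Longrightarrow> c x = c y \<Longrightarrow>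
       (\<Sum>i\<le>t. \<bar>x i - y i\<bar>) \<le> (t + 1)\<^sup>2 / M"
proof -
  have "\<exists>i\<le>t. \<bar>x i\<bar> \<ge> 1 / (t + 1)" if "x \<in> topspace (nsphere t)" for x
  proof (rule ccontr)
    assume "\<not> ?thesis"
    then have lt: "\<bar>x i\<bar> < 1 / (t + 1)" if "i \<le> t" for i using that by force
    have "(x i)\<^sup>2 < 1 / (t + 1)" if "i \<le> t" for i
    proof -
      have "(x i)\<^sup>2 = \<bar>x i\<bar> * \<bar>x i\<bar>" by (simp add: power2_eq_square)
      also have "\<dots> \<le> \<bar>x i\<bar> * 1" using abs_le_1_nsphere[OF \<open>x \<in> _\<close>] by (intro mult_left_mono) auto
      finally show ?thesis using lt[OF that] by simp
    qed
    then have "(\<Sum>i\<le>t. (x i)\<^sup>2) < (\<Sum>i\<le>t. 1 / (t + 1))"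
      by (intro sum_strict_mono) auto
    then show False using that by (simp add: topspace_nsphere)
  qed
  then obtain p where p: "\<And>x. x \<in> topspace (nsphere t) \<Longrightarrow> p x \<le> t \<and> \<bar>x (p x)\<bar> \<ge> 1 / (t + 1)"
    by metis
  \<comment> \<open>The code of a point: the index of a large coordinate, its sign, and the boxes of
    side \<open>1 / M\<close> containing the other coordinates.\<close>
  define c where "c x = (p x, x (p x) \<ge> 0, \<lambda>j\<in>{..t} - {p x}. \<lfloor>M * x j\<rfloor>)" for x :: "nat \<Rightarrow> real"
  define C where "C = (SIGMA i:{..t}. (UNIV :: bool set) \<times> (PiE ({..t} - {i}) (\<lambda>_. {- int M..int M})))"
  have cardC: "card C = 2 * (t + 1) * (2 * M + 1) ^ t"
  proof -
    have "card ((UNIV :: bool set) \<times> (PiE ({..t} - {i}) (\<lambda>_. {- int M..int M}))) = 2 * (2 * M + 1) ^ t"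
      if "i \<in> {..t}" for i
      using that by (simp add: card_cartesian_product card_PiE nat_add_distrib nat_mult_distrib)
    then show ?thesis unfolding C_def
      by (subst card_SigmaI) (auto intro!: finite_PiE)
  qed
  have sub: "c ` topspace (nsphere t) \<subseteq> C"
  proof
    fix z assume "z \<in> c ` topspace (nsphere t)"
    then obtain x where x: "x \<in> topspace (nsphere t)" "z = c x" by auto
    have "\<lfloor>M * x j\<rfloor> \<in> {- int M..int M}" for j
    proof -
      have "\<bar>M * x j\<bar> \<le> M" using abs_le_1_nsphere[OF x(1), of j] by (simp add: abs_mult mult_left_le)
      then show ?thesis by (simp add: le_floor_iff abs_le_iff) linarith
    qed
    then show "z \<in> C" using p[OF x(1)] by (auto simp: x c_def C_def)
  qed
  have dist: "(\<Sum>i\<le>t. \<bar>x i - y i\<bar>) \<le> (t + 1)\<^sup>2 / M"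
    if x: "x \<in> topspace (nsphere t)" and y: "y \<in> topspace (nsphere t)" and eq: "c x = c y" for x y
  proof -
    define i where "i = p x"
    have i: "p y = i" "i \<le> t" "(x i \<ge> 0) = (y i \<ge> 0)"
      "(\<lambda>j\<in>{..t} - {i}. \<lfloor>M * x j\<rfloor>) = (\<lambda>j\<in>{..t} - {i}. \<lfloor>M * y j\<rfloor>)"
      using eq p[OF x] by (auto simp: c_def i_def)
    have d: "\<bar>x j - y j\<bar> \<le> 1 / M" if "j \<in> {..t} - {i}" for j
    proof -
      have "\<lfloor>M * x j\<rfloor> = \<lfloor>M * y j\<rfloor>" using fun_cong[OF i(4), of j] that by simp
      then have "\<bar>M * x j - M * y j\<bar> \<le> 1" by linarith
      then have "M * \<bar>x j - y j\<bar> \<le> 1" by (simp add: abs_mult flip: right_diff_distrib)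
      then show ?thesis using assms by (simp add: field_simps)
    qed
    have rest: "(\<Sum>j\<in>{..t}-{i}. \<bar>x j - y j\<bar>) \<le> t / M"
      using sum_bounded_above[of "{..t}-{i}" "\<lambda>j. \<bar>x j - y j\<bar>" "1 / M"] d i(2) by simp
    have sq: "\<bar>(x j)\<^sup>2 - (y j)\<^sup>2\<bar> \<le> 2 * \<bar>x j - y j\<bar>" for j
    proof -
      have "\<bar>(x j)\<^sup>2 - (y j)\<^sup>2\<bar> = \<bar>x j + y j\<bar> * \<bar>x j - y j\<bar>"
        by (simp add: power2_eq_square square_diff_square_factored abs_mult)
      also have "\<dots> \<le> 2 * \<bar>x j - y j\<bar>"
        using abs_le_1_nsphere[OF x, of j] abs_le_1_nsphere[OF y, of j] by (intro mult_right_mono) auto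
      finally show ?thesis .
    qed
    have "(x i)\<^sup>2 - (y i)\<^sup>2 = - (\<Sum>j\<in>{..t}-{i}. (x j)\<^sup>2 - (y j)\<^sup>2)"
    proof -
      have "(\<Sum>j\<le>t. (x j)\<^sup>2) = (x i)\<^sup>2 + (\<Sum>j\<in>{..t}-{i}. (x j)\<^sup>2)"
           "(\<Sum>j\<le>t. (y j)\<^sup>2) = (y i)\<^sup>2 + (\<Sum>j\<in>{..t}-{i}. (y j)\<^sup>2)"
        using i(2) by (auto intro: sum.remove)
      then show ?thesis using x y by (simp add: topspace_nsphere sum_subtractf)
    qed
    then have "\<bar>(x i)\<^sup>2 - (y i)\<^sup>2\<bar> \<le> (\<Sum>j\<in>{..t}-{i}. \<bar>(x j)\<^sup>2 - (y j)\<^sup>2\<bar>)"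
      by (simp only: abs_minus_cancel sum_abs)
    also have "\<dots> \<le> (\<Sum>j\<in>{..t}-{i}. 2 * \<bar>x j - y j\<bar>)" by (intro sum_mono sq)
    also have "\<dots> \<le> 2 * (t / M)" using rest by (simp flip: sum_distrib_left)
    finally have q: "\<bar>x i + y i\<bar> * \<bar>x i - y i\<bar> \<le> 2 * (t / M)"
      by (simp add: power2_eq_square square_diff_square_factored abs_mult)
    \<comment> \<open>Equal signs prevent cancellation, so the estimate for the difference of the
      squares can be divided by this sum.\<close>
    have "\<bar>x i + y i\<bar> \<ge> 2 / (t + 1)"
    proof -
      have "\<bar>x i\<bar> \<ge> 1 / (t + 1)" "\<bar>y i\<bar> \<ge> 1 / (t + 1)" using p[OF x] p[OF y] i by (auto simp: i_def)
      moreover have "\<bar>x i + y i\<bar> = \<bar>x i\<bar> + \<bar>y i\<bar>" using i(3) by auto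
      ultimately show ?thesis by simp
    qed
    then have "2 / (t + 1) * \<bar>x i - y i\<bar> \<le> 2 * (t / M)"
      using q by (meson abs_ge_zero mult_right_mono order_trans)
    then have "(t + 1) / 2 * (2 / (t + 1) * \<bar>x i - y i\<bar>) \<le> (t + 1) / 2 * (2 * (t / M))"
      by (intro mult_left_mono) auto
    then have "\<bar>x i - y i\<bar> \<le> (t + 1) * (t / M)" by simp
    moreover have "(\<Sum>j\<le>t. \<bar>x j - y j\<bar>) = \<bar>x i - y i\<bar> + (\<Sum>j\<in>{..t}-{i}. \<bar>x j - y j\<bar>)"
      using i(2) by (auto intro: sum.remove)
    ultimately have "(\<Sum>j\<le>t. \<bar>x j - y j\<bar>) \<le> (t + 1) * (t / M) + t / M" using rest by linarith
    also have "\<dots> \<le> (t + 1)\<^sup>2 / M"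
      using assms by (simp add: field_simps power2_eq_square)
    finally show ?thesis .
  qed
  have "finite C" unfolding C_def by (auto intro!: finite_SigmaI finite_PiE)
  moreover have "card C \<le> 2 * (t + 1) * (3 * M) ^ t"
    unfolding cardC using assms by (intro mult_left_mono power_mono) auto
  ultimately show thesis using sub dist that by blast
qed

text \<open>Suppose that all \<open>N ^ card U\<close> points of a grid with spacing
  \<open>\<epsilon> / N\<close> are hit. Their preimages lie in different boxes of the cover with
  parameter \<open>a * N\<close>, because \<open>a\<close> is so large that points of one box have
  images closer than the spacing. There are at most a constant times \<open>N ^ t\<close> boxes,
  fewer than \<open>N ^ (t + 1)\<close>.\<close>

lemma lipschitz_image_misses_point:
  fixes g :: "'u \<Rightarrow> (nat \<Rightarrow> real) \<Rightarrow> real"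
  assumes U: "finite U" "card U \<ge> t + 1" and "\<epsilon> > 0"
    and lip: "\<And>u x y. u \<in> U \<Longrightarrow> x \<in> topspace (nsphere t) \<Longrightarrow> y \<in> topspace (nsphere t) \<Longrightarrow>
       \<bar>g u x - g u y\<bar> \<le> L * (\<Sum>i\<le>t. \<bar>x i - y i\<bar>)"
  obtains q where "\<And>u. u \<in> U \<Longrightarrow> \<bar>q u - b\<bar> \<le> \<epsilon>"
    "\<And>x. x \<in> topspace (nsphere t) \<Longrightarrow> \<exists>u\<in>U. g u x \<noteq> q u"
proof (rule ccontr)
  note obt = that
  assume "\<not> thesis"
  then have hit: "\<exists>x. x \<in> topspace (nsphere t) \<and> (\<forall>u\<in>U. g u x = q u)" if "\<And>u. u \<in> U \<Longrightarrow> \<bar>q u - b\<bar> \<le> \<epsilon>" for q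
    using obt[of q] that by blast
  obtain a :: nat where a: "(t + 1)\<^sup>2 * \<bar>L\<bar> / \<epsilon> < a" "a \<ge> 1"
  proof -
    obtain a0 :: nat where "(t + 1)\<^sup>2 * \<bar>L\<bar> / \<epsilon> < a0" using reals_Archimedean2 by blast
    then show ?thesis using that[of "Suc a0"] by simp
  qed
  \<comment> \<open>One more than the factor in front of \<open>N ^ t\<close> in the number of boxes
    for the parameter \<open>a * N\<close>; this factor depends only on \<open>a\<close> and
    \<open>t\<close>.\<close>
  define N where "N = 2 * (t + 1) * (3 * a) ^ t + 1"
  have N: "N \<ge> 1" by (simp add: N_def)
  define q where "q z u = b + \<epsilon> * (real (z u) / real N)" for z :: "'u \<Rightarrow> nat" and u
  define Z where "Z = PiE U (\<lambda>_. {..<N})"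
  have "\<exists>x. x \<in> topspace (nsphere t) \<and> (\<forall>u\<in>U. g u x = q z u)" if "z \<in> Z" for z
  proof (rule hit)
    fix u assume "u \<in> U"
    then have "z u < N" using that by (auto simp: Z_def)
    then have "\<epsilon> * (real (z u) / real N) \<le> \<epsilon>" using \<open>\<epsilon> > 0\<close> by (intro mult_left_le) auto
    then show "\<bar>q z u - b\<bar> \<le> \<epsilon>" using \<open>\<epsilon> > 0\<close> by (simp add: q_def)
  qed
  then obtain X where X: "\<And>z. z \<in> Z \<Longrightarrow> X z \<in> topspace (nsphere t)" "\<And>z u. z \<in> Z \<Longrightarrow> u \<in> U \<Longrightarrow> g u (X z) = q z u"
    by metis
  have "a * N \<ge> 1" using a N by simp
  then obtain c C where c: "finite C" "card C \<le> 2 * (t + 1) * (3 * (a * N)) ^ t"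
    "c ` topspace (nsphere t) \<subseteq> (C :: (nat \<times> bool \<times> (nat \<Rightarrow> int)) set)"
    "\<And>x y. x \<in> topspace (nsphere t) \<Longrightarrow> y \<in> topspace (nsphere t) \<Longrightarrow> c x = c y \<Longrightarrow>
       (\<Sum>i\<le>t. \<bar>x i - y i\<bar>) \<le> (t + 1)\<^sup>2 / real (a * N)"
    by (rule nsphere_cover[of "a * N" t]) blast
  have "inj_on (c \<circ> X) Z"
  proof (rule inj_onI, rule ccontr)
    fix z z' assume z: "z \<in> Z" "z' \<in> Z" "(c \<circ> X) z = (c \<circ> X) z'" "z \<noteq> z'"
    then obtain u where u: "u \<in> U" "z u \<noteq> z' u" unfolding Z_def by (metis PiE_ext)
    have "\<epsilon> / N \<le> \<epsilon> * \<bar>real (z u) - real (z' u)\<bar> / N"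
      using u(2) \<open>\<epsilon> > 0\<close> by (intro divide_right_mono) auto
    also have "\<dots> = \<bar>g u (X z) - g u (X z')\<bar>"
    proof -
      have "g u (X z) - g u (X z') = \<epsilon> * (real (z u) - real (z' u)) / N"
        using X(2)[OF z(1) u(1)] X(2)[OF z(2) u(1)] by (simp add: q_def right_diff_distrib diff_divide_distrib)
      then show ?thesis using \<open>\<epsilon> > 0\<close> by (simp add: abs_mult)
    qed
    also have "\<dots> \<le> L * (\<Sum>i\<le>t. \<bar>X z i - X z' i\<bar>)" using lip[OF u(1)] X(1) z by blast
    also have "\<dots> \<le> \<bar>L\<bar> * (\<Sum>i\<le>t. \<bar>X z i - X z' i\<bar>)" by (intro mult_right_mono) (auto intro: sum_nonneg)
    also have "\<dots> \<le> \<bar>L\<bar> * ((t + 1)\<^sup>2 / real (a * N))" using c(4)[of "X z" "X z'"] X(1) z by (intro mult_left_mono) auto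
    finally have "\<epsilon> * a \<le> \<bar>L\<bar> * (t + 1)\<^sup>2" using N a by (simp add: field_simps)
    then show False using a(1) \<open>\<epsilon> > 0\<close> by (simp add: field_simps)
  qed
  moreover have "(c \<circ> X) ` Z \<subseteq> C" using c(3) X(1) by auto
  ultimately have "card Z \<le> card C" using c(1) card_inj_on_le by blast
  moreover have "card Z = N ^ card U" using U by (simp add: Z_def card_PiE)
  moreover have "N ^ (t + 1) \<le> N ^ card U" using U N by (intro power_increasing) auto
  ultimately have "N ^ (t + 1) \<le> 2 * (t + 1) * (3 * (a * N)) ^ t" using c(2) by linarith
  then have "N * N ^ t \<le> (2 * (t + 1) * (3 * a) ^ t) * N ^ t" by (simp add: power_mult_distrib mult_ac)
  then have "N \<le> 2 * (t + 1) * (3 * a) ^ t" using N by (simp del: mult_Suc_right)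
  then show False by (simp add: N_def)
qed

text \<open>Stone-Weierstrass for the ring of Lipschitz functions. Products stay Lipschitz because
  the factors are bounded on the compact sphere, and the coordinate functions separate
  points.\<close>

lemma lipschitz_approximation_nsphere:
  assumes f: "continuous_map (nsphere t) euclideanreal f" and "e > 0"
  obtains g L where "\<And>x. x \<in> topspace (nsphere t) \<Longrightarrow> \<bar>f x - g x\<bar> < e"
    "\<And>x y. x \<in> topspace (nsphere t) \<Longrightarrow> y \<in> topspace (nsphere t) \<Longrightarrow> \<bar>g x - g y\<bar> \<le> L * (\<Sum>i\<le>t. \<bar>x i - y i\<bar>)"
    "continuous_map (nsphere t) euclideanreal g"
proof -
  let ?S = "topspace (nsphere t)"
  define D where "D x y = (\<Sum>i\<le>t. \<bar>x i - y i\<bar>)" for x y :: "nat \<Rightarrow> real"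
  have D0: "D x y \<ge> 0" for x y by (auto simp: D_def intro: sum_nonneg)
  have top: "nsphere t = top_of_set ?S"
    unfolding topspace_nsphere by (simp only: nsphere euclidean_product_topology)
  define R where "R = {g. continuous_on ?S g \<and> (\<exists>L\<ge>0. \<forall>x\<in>?S. \<forall>y\<in>?S. \<bar>g x - g y\<bar> \<le> L * D x y)}"
  interpret function_ring_on R ?S
  proof
    show "compact ?S" by (rule compact_nsphere)
    show "continuous_on ?S g" if "g \<in> R" for g using that by (simp add: R_def)
    show "(\<lambda>_. c) \<in> R" for c using D0 by (auto simp: R_def)
  next
    fix g h assume "g \<in> R" "h \<in> R"
    then obtain L L' where L: "L \<ge> 0" "L' \<ge> 0" "\<And>x y. x\<in>?S \<Longrightarrow> y\<in>?S \<Longrightarrow> \<bar>g x - g y\<bar> \<le> L * D x y"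
      "\<And>x y. x\<in>?S \<Longrightarrow> y\<in>?S \<Longrightarrow> \<bar>h x - h y\<bar> \<le> L' * D x y" and cont: "continuous_on ?S g" "continuous_on ?S h"
      unfolding R_def by blast
    have "\<bar>(g x + h x) - (g y + h y)\<bar> \<le> (L + L') * D x y" if "x \<in> ?S" "y \<in> ?S" for x y
      using L(3)[OF that] L(4)[OF that] by (simp add: distrib_right)
    moreover have "continuous_on ?S (\<lambda>x. g x + h x)" by (intro continuous_intros cont)
    ultimately show "(\<lambda>x. g x + h x) \<in> R" using L(1,2) unfolding R_def
      by (auto intro: exI[of _ "L + L'"])
    obtain B B' where B: "\<And>x. x \<in> ?S \<Longrightarrow> \<bar>g x\<bar> \<le> B" "\<And>x. x \<in> ?S \<Longrightarrow> \<bar>h x\<bar> \<le> B'" "B \<ge> 0" "B' \<ge> 0"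
    proof -
      have "\<exists>B\<ge>0. \<forall>x\<in>?S. \<bar>k x\<bar> \<le> B" if "continuous_on ?S k" for k :: "(nat \<Rightarrow> real) \<Rightarrow> real"
      proof -
        have "bounded (k ` ?S)" using that compact_nsphere compact_continuous_image compact_imp_bounded by blast
        then obtain B where "B > 0" "\<forall>y\<in>k ` ?S. norm y \<le> B" using bounded_pos by blast
        then show ?thesis by (intro exI[of _ B]) auto
      qed
      then show ?thesis using that cont by metis
    qed
    have "\<bar>g x * h x - g y * h y\<bar> \<le> (B * L' + B' * L) * D x y" if xy: "x \<in> ?S" "y \<in> ?S" for x y
    proof -
      have "g x * h x - g y * h y = g x * (h x - h y) + h y * (g x - g y)" by (simp add: algebra_simps)
      then have "\<bar>g x * h x - g y * h y\<bar> \<le> \<bar>g x\<bar> * \<bar>h x - h y\<bar> + \<bar>h y\<bar> * \<bar>g x - g y\<bar>"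
        by (metis abs_mult abs_triangle_ineq)
      also have "\<dots> \<le> B * (L' * D x y) + B' * (L * D x y)"
        using L(3)[OF xy] L(4)[OF xy] B xy by (intro add_mono mult_mono) auto
      finally show ?thesis by (simp add: algebra_simps)
    qed
    moreover have "continuous_on ?S (\<lambda>x. g x * h x)" by (intro continuous_intros cont)
    moreover have "0 \<le> B * L' + B' * L" using L(1,2) B(3,4) by simp
    ultimately show "(\<lambda>x. g x * h x) \<in> R" unfolding R_def by blast
  next
    fix x y assume xy: "x \<in> ?S" "y \<in> ?S" "x \<noteq> y"
    then obtain i where i: "x i \<noteq> y i" by auto
    then have it: "i \<le> t" using xy by (auto simp: topspace_nsphere not_le[symmetric])
    have "continuous_on ?S (\<lambda>x. x i)"
      by (rule continuous_on_subset[OF continuous_on_product_coordinates]) simp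
    moreover have "\<bar>x i - y i\<bar> \<le> 1 * D x y" for x y
      using member_le_sum[of i "{..t}" "\<lambda>i. \<bar>x i - y i\<bar>"] it by (simp add: D_def)
    ultimately have "(\<lambda>x. x i) \<in> R" unfolding R_def by (blast intro: zero_le_one)
    then show "\<exists>f\<in>R. f x \<noteq> f y" using i by (intro bexI[of _ "\<lambda>x. x i"])
  qed
  have "continuous_map (top_of_set ?S) euclideanreal f" using f by (simp only: top[symmetric])
  then have "continuous_on ?S f" by simp
  from Stone_Weierstrass_basic[OF this \<open>e > 0\<close>] obtain g where g: "g \<in> R" "\<forall>x\<in>?S. \<bar>f x - g x\<bar> < e" by blast
  then have "continuous_map (top_of_set ?S) euclideanreal g" by (simp add: R_def)
  then have "continuous_map (nsphere t) euclideanreal g" by (simp only: top[symmetric])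
  then show thesis using g that unfolding R_def D_def by blast
qed

section \<open>Connectivity of geometric realizations\<close>

lemma topspace_geom_realization:
  "topspace (geom_realization V K) =
    {x \<in> extensional V. (\<forall>v\<in>V. 0 \<le> x v) \<and> sum x V = 1 \<and> {v\<in>V. x v \<noteq> 0} \<in> K}"
  by (auto simp: geom_realization_def PiE_def)

lemma continuous_map_geom_realization:
  "continuous_map T (geom_realization V K) f \<longleftrightarrow>
    (\<forall>v\<in>V. continuous_map T euclideanreal (\<lambda>x. f x v)) \<and>
    (\<forall>x\<in>topspace T. f x \<in> topspace (geom_realization V K))"
  unfolding topspace_geom_realization
  by (auto simp: geom_realization_def continuous_map_in_subtopology continuous_map_componentwise PiE_def)

text \<open>The segment from \<open>f x\<close> to \<open>g x\<close> stays in the closed simplex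
  \<sigma> that carries both ends.\<close>

lemma homotopic_with_geom_realization_linear:
  assumes f: "continuous_map T (geom_realization V K) f" and g: "continuous_map T (geom_realization V K) g"
    and K: "down_closed K"
    and car: "\<And>x. x \<in> topspace T \<Longrightarrow> \<exists>\<sigma>\<in>K. \<forall>v\<in>V. f x v \<noteq> 0 \<or> g x v \<noteq> 0 \<longrightarrow> v \<in> \<sigma>"
  shows "homotopic_with (\<lambda>h. True) T (geom_realization V K) f g"
proof -
  define h where "h z = (\<lambda>v\<in>V. (1 - fst z) * f (snd z) v + fst z * g (snd z) v)" for z :: "real \<times> 'a"
  have "continuous_map (prod_topology (top_of_set {0..1}) T) (geom_realization V K) h"
    unfolding continuous_map_geom_realization
  proof (intro conjI ballI)
    fix v assume v: "v \<in> V"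
    have 1: "continuous_map (prod_topology (top_of_set {0..1::real}) T) euclideanreal fst"
      by (rule continuous_map_into_fulltopology[OF continuous_map_fst])
    have "continuous_map T euclideanreal (\<lambda>x. f x v)" "continuous_map T euclideanreal (\<lambda>x. g x v)"
      using f g v by (auto simp: continuous_map_geom_realization)
    note 2 = this[THEN continuous_map_compose[OF continuous_map_snd], unfolded o_def]
    have "continuous_map (prod_topology (top_of_set {0..1::real}) T) euclideanreal
        (\<lambda>z. (1 - fst z) * f (snd z) v + fst z * g (snd z) v)"
      by (intro continuous_map_add continuous_map_real_mult continuous_map_diff 1 2) simp
    then show "continuous_map (prod_topology (top_of_set {0..1::real}) T) euclideanreal (\<lambda>z. h z v)"
      using v by (simp add: h_def)
  next
    fix z assume "z \<in> topspace (prod_topology (top_of_set {0..1::real}) T)"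
    then obtain \<theta> x where z: "z = (\<theta>, x)" "0 \<le> \<theta>" "\<theta> \<le> 1" "x \<in> topspace T" by auto
    have fx: "f x \<in> topspace (geom_realization V K)" "g x \<in> topspace (geom_realization V K)"
      using f g z by (auto simp: continuous_map_geom_realization)
    obtain \<sigma> where \<sigma>: "\<sigma> \<in> K" "\<forall>v\<in>V. f x v \<noteq> 0 \<or> g x v \<noteq> 0 \<longrightarrow> v \<in> \<sigma>" using car[OF z(4)] by blast
    have "{v \<in> V. h z v \<noteq> 0} \<subseteq> \<sigma>" using \<sigma>(2) by (auto simp: h_def z)
    moreover have "sum (h z) V = (1 - \<theta>) * sum (f x) V + \<theta> * sum (g x) V"
      by (simp add: h_def z sum.distrib sum_distrib_left)
    moreover have "{v \<in> V. h z v \<noteq> 0} \<in> K" using K \<sigma>(1) calculation(1) by (rule down_closedD)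
    moreover have "h z \<in> extensional V" "\<forall>v\<in>V. 0 \<le> h z v"
      using fx z(2,3) by (auto simp: topspace_geom_realization h_def z)
    ultimately show "h z \<in> topspace (geom_realization V K)"
      using fx by (simp add: topspace_geom_realization)
  qed
  moreover have "h (0, x) = f x" "h (1, x) = g x" if "x \<in> topspace T" for x
  proof -
    have "f x \<in> extensional V" "g x \<in> extensional V"
      using f g that by (auto simp: continuous_map_geom_realization topspace_geom_realization)
    then show "h (0, x) = f x" "h (1, x) = g x" by (auto simp: h_def fun_eq_iff extensional_def)
  qed
  ultimately show ?thesis by (subst homotopic_with) auto
qed

text \<open>Half of a homotopy equivalence suffices: a sphere map is deformed into the smaller
  complex and contracted there. Both kinds of building steps use this. With
  \<open>c \<ge> -1\<close> the smaller complex has a point.\<close>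

lemma c_connected_geom_realization_mono:
  assumes c: "c_connected c (geom_realization V K)" and "c \<ge> -1" and KK: "K \<subseteq> K'"
    and push: "\<And>t f. int t \<le> c \<Longrightarrow> continuous_map (nsphere t) (geom_realization V K') f \<Longrightarrow>
      \<exists>g. continuous_map (nsphere t) (geom_realization V K) g \<and>
        homotopic_with (\<lambda>h. True) (nsphere t) (geom_realization V K') f g"
  shows "c_connected c (geom_realization V K')"
  unfolding c_connected_def
proof (intro disjI2 conjI allI impI)
  have sub: "topspace (geom_realization V K) \<subseteq> topspace (geom_realization V K')"
    using KK by (auto simp: topspace_geom_realization)
  then show "topspace (geom_realization V K') \<noteq> {}"
    using c \<open>c \<ge> -1\<close> by (auto simp: c_connected_def)
  fix t f assume t: "int t \<le> c" and f: "continuous_map (nsphere t) (geom_realization V K') f"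
  obtain g where g: "continuous_map (nsphere t) (geom_realization V K) g"
    "homotopic_with (\<lambda>h. True) (nsphere t) (geom_realization V K') f g" using push[OF t f] by blast
  obtain a where a: "homotopic_with (\<lambda>h. True) (nsphere t) (geom_realization V K) g (\<lambda>x. a)"
    using c t g(1) \<open>c \<ge> -1\<close> unfolding c_connected_def by fastforce
  have "continuous_map (geom_realization V K) (geom_realization V K) id" by simp
  then have "continuous_map (geom_realization V K) (geom_realization V K') id"
    using sub unfolding continuous_map_geom_realization by auto
  from homotopic_with_compose_continuous_map_left[OF a this]
  have "homotopic_with (\<lambda>h. True) (nsphere t) (geom_realization V K') g (\<lambda>x. a)" by (simp add: o_def)
  then show "\<exists>a. homotopic_with (\<lambda>h. True) (nsphere t) (geom_realization V K') f (\<lambda>x. a)"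
    using g(2) homotopic_with_trans by blast
qed

section \<open>Deforming maps across one building step\<close>

lemma continuous_map_Min:
  assumes "finite U" "U \<noteq> {}" "\<And>u. u \<in> U \<Longrightarrow> continuous_map T euclideanreal (\<lambda>x. f x u)"
  shows "continuous_map T euclideanreal (\<lambda>x. Min (f x ` U))"
  using assms
proof (induction U rule: finite_ne_induct)
  case (singleton u)
  then show ?case by simp
next
  case (insert u U)
  then show ?case by (simp add: continuous_map_real_min)
qed

text \<open>Subtracting the minimum of the coordinates over \<open>\<tau>\<close> from each of them and adding the lost mass
  to \<open>v\<close> moves only points of the open simplices \<open>\<tau>\<close> and \<open>insert v \<tau>\<close>.\<close>

lemma expansion_retraction:
  assumes V: "finite V" "insert v \<tau> \<subseteq> V" and "v \<notin> \<tau>" "\<tau> \<noteq> {}" and K: "down_closed K" "\<tau> \<notin> K"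
    and K': "K' = insert \<tau> (insert (insert v \<tau>) K)" "down_closed K'"
    and faces: "\<And>\<rho>. \<rho> \<subset> insert v \<tau> \<Longrightarrow> \<rho> \<noteq> \<tau> \<Longrightarrow> \<rho> \<in> K"
    and f: "continuous_map T (geom_realization V K') f"
  shows "\<exists>g. continuous_map T (geom_realization V K) g \<and>
    homotopic_with (\<lambda>h. True) T (geom_realization V K') f g"
proof -
  have fin: "finite \<tau>" "\<tau> \<subseteq> V" "v \<in> V" using V finite_subset by auto
  define m where "m x = Min (f x ` \<tau>)" for x
  \<comment> \<open>The direction of the flow: each vertex of \<tau> loses one unit and
    \<open>v\<close> receives all of them, so the total mass is preserved.\<close>
  define c where "c w = (if w = v then real (card \<tau>) else 0) - (if w \<in> \<tau> then 1 else 0)" for w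
  define g where "g x = (\<lambda>w\<in>V. f x w + m x * c w)" for x
  have fc: "continuous_map T euclideanreal (\<lambda>x. f x w)" if "w \<in> V" for w
    using f that by (simp add: continuous_map_geom_realization)
  have fx: "f x \<in> topspace (geom_realization V K')" if "x \<in> topspace T" for x
    using f that by (simp add: continuous_map_geom_realization)
  have mc: "continuous_map T euclideanreal m"
    unfolding m_def using fin fc assms(4) by (intro continuous_map_Min) auto
  have sumc: "sum c V = 0"
  proof -
    have "(\<Sum>w\<in>V. if w \<in> \<tau> then 1 else 0) = (\<Sum>w\<in>\<tau>. 1::real)"
      using fin V by (simp add: sum.If_cases Int_absorb1)
    then show ?thesis using fin V by (simp add: c_def sum_subtractf)
  qed
  have main: "g x \<in> topspace (geom_realization V K) \<and> (\<exists>\<sigma>\<in>K'. \<forall>w\<in>V. f x w \<noteq> 0 \<or> g x w \<noteq> 0 \<longrightarrow> w \<in> \<sigma>)"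
    if x: "x \<in> topspace T" for x
  proof -
    let ?S = "{w \<in> V. f x w \<noteq> 0}"
    have F: "\<forall>w\<in>V. 0 \<le> f x w" "sum (f x) V = 1" "?S \<in> K'"
      using fx[OF x] by (auto simp: topspace_geom_realization)
    have mle: "m x \<le> f x u" if "u \<in> \<tau>" for u using that fin by (simp add: m_def)
    have "m x \<in> f x ` \<tau>" unfolding m_def using fin assms(4) by (intro Min_in) auto
    then obtain u0 where u0: "u0 \<in> \<tau>" "f x u0 = m x" by force
    have m0: "m x \<ge> 0" using u0 F fin by force
    have nonneg: "0 \<le> g x w" if "w \<in> V" for w
      using that F m0 mle[of w] assms(3) by (auto simp: g_def c_def)
    have sum: "sum (g x) V = 1"
      using F(2) sumc by (simp add: g_def sum.distrib flip: sum_distrib_left)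
    have "{w \<in> V. g x w \<noteq> 0} \<in> K \<and> (\<exists>\<sigma>\<in>K'. \<forall>w\<in>V. f x w \<noteq> 0 \<or> g x w \<noteq> 0 \<longrightarrow> w \<in> \<sigma>)"
    proof (cases "m x = 0")
      case True
      then have gf: "g x w = f x w" if "w \<in> V" for w using that by (simp add: g_def)
      then have "{w \<in> V. g x w \<noteq> 0} = ?S" by auto
      moreover have "u0 \<notin> ?S" using u0 True by auto
      then have "?S \<in> K" using F(3) K' u0(1) by auto
      moreover have "?S \<in> K' \<and> (\<forall>w\<in>V. f x w \<noteq> 0 \<or> g x w \<noteq> 0 \<longrightarrow> w \<in> ?S)" using F(3) gf by auto
      ultimately show ?thesis by (intro conjI bexI[of _ ?S]) auto
    next
      case False
      \<comment> \<open>A positive minimum means that all of \<tau> carries mass, so the support is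
        one of the two new simplices.\<close>
      then have "\<tau> \<subseteq> ?S" using mle m0 fin by force
      then have "?S \<notin> K" using K down_closedD by blast
      then have S: "?S \<subseteq> insert v \<tau>" using F(3) K'(1) by auto
      have gS: "w \<in> insert v \<tau>" if "w \<in> V" "g x w \<noteq> 0" for w
      proof (rule ccontr)
        assume w: "w \<notin> insert v \<tau>"
        then have "f x w = 0" using S that by auto
        then show False using w that by (simp add: g_def c_def)
      qed
      \<comment> \<open>The vertex attaining the minimum is emptied; the new support is thus a face
        of \<open>insert v \<tau>\<close> that already belongs to \<open>K\<close>.\<close>
      moreover have "g x u0 = 0" using u0 assms(3) fin by (auto simp: g_def c_def)
      ultimately have "{w \<in> V. g x w \<noteq> 0} \<subset> insert v \<tau>" "{w \<in> V. g x w \<noteq> 0} \<noteq> \<tau>" using u0(1) by auto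
      then have "{w \<in> V. g x w \<noteq> 0} \<in> K" by (rule faces)
      moreover have "insert v \<tau> \<in> K'" by (simp add: K')
      moreover have "\<forall>w\<in>V. f x w \<noteq> 0 \<or> g x w \<noteq> 0 \<longrightarrow> w \<in> insert v \<tau>" using S gS by blast
      ultimately show ?thesis by blast
    qed
    then show ?thesis using nonneg sum by (auto simp: topspace_geom_realization g_def)
  qed
  have gcont: "continuous_map T euclideanreal (\<lambda>x. g x w)" if "w \<in> V" for w
  proof -
    have "continuous_map T euclideanreal (\<lambda>x. f x w + m x * c w)"
      by (intro continuous_map_add continuous_map_real_mult fc mc that) simp
    then show ?thesis using that by (simp add: g_def)
  qed
  then have g: "continuous_map T (geom_realization V K) g"
    using main by (simp add: continuous_map_geom_realization)
  have "K \<subseteq> K'" by (auto simp: K')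
  then have "continuous_map T (geom_realization V K') g"
    using gcont main by (auto simp: continuous_map_geom_realization topspace_geom_realization)
  then have "homotopic_with (\<lambda>h. True) T (geom_realization V K') f g"
    using main by (intro homotopic_with_geom_realization_linear[OF f _ K'(2)]) auto
  then show ?thesis using g by blast
qed

text \<open>The projection from \<open>p\<close> to the boundary of \<open>\<sigma>\<close> is \<open>x \<mapsto> (x - \<mu> p) / (1 - \<mu>)\<close> with \<open>\<mu>\<close> the minimum
  of \<open>x u / p u\<close> over \<open>\<sigma>\<close>; this formula is the identity on the rest of the complex, where \<open>\<mu> = 0\<close>.\<close>

lemma radial_projection:
  assumes V: "finite V" "\<sigma> \<subseteq> V" and "\<sigma> \<noteq> {}" and K: "down_closed K" "\<sigma> \<notin> K"
    and K': "K' = insert \<sigma> K" "down_closed K'"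
    and faces: "\<And>\<rho>. \<rho> \<subset> \<sigma> \<Longrightarrow> \<rho> \<in> K"
    and f: "continuous_map T (geom_realization V K') f"
    and p: "\<And>u. u \<in> \<sigma> \<Longrightarrow> p u > 0" "\<And>u. u \<in> V - \<sigma> \<Longrightarrow> p u = 0" "sum p V = (1::real)"
    and miss: "\<And>x. x \<in> topspace T \<Longrightarrow> \<exists>w\<in>V. f x w \<noteq> p w"
  shows "\<exists>g. continuous_map T (geom_realization V K) g \<and>
    homotopic_with (\<lambda>h. True) T (geom_realization V K') f g"
proof -
  have fin: "finite \<sigma>" using V finite_subset by auto
  define m where "m x = Min ((\<lambda>u. f x u / p u) ` \<sigma>)" for x
  define g where "g x = (\<lambda>w\<in>V. (f x w - m x * p w) / (1 - m x))" for x
  have fc: "continuous_map T euclideanreal (\<lambda>x. f x w)" if "w \<in> V" for w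
    using f that by (simp add: continuous_map_geom_realization)
  have fx: "f x \<in> topspace (geom_realization V K')" if "x \<in> topspace T" for x
    using f that by (simp add: continuous_map_geom_realization)
  have mc: "continuous_map T euclideanreal m"
  proof -
    have "continuous_map T euclideanreal (\<lambda>x. f x u / p u)" if "u \<in> \<sigma>" for u
      using p(1)[OF that] V that by (intro continuous_map_real_divide fc) auto
    then show ?thesis unfolding m_def using fin assms(3) by (intro continuous_map_Min) auto
  qed
  have main: "m x < 1 \<and> g x \<in> topspace (geom_realization V K) \<and> (\<exists>\<sigma>\<in>K'. \<forall>w\<in>V. f x w \<noteq> 0 \<or> g x w \<noteq> 0 \<longrightarrow> w \<in> \<sigma>)"
    if x: "x \<in> topspace T" for x
  proof -
    let ?S = "{w \<in> V. f x w \<noteq> 0}"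
    have F: "\<forall>w\<in>V. 0 \<le> f x w" "sum (f x) V = 1" "?S \<in> K'"
      using fx[OF x] by (auto simp: topspace_geom_realization)
    have mle: "m x * p u \<le> f x u" if "u \<in> \<sigma>" for u
    proof -
      have "m x \<le> f x u / p u" using that fin by (simp add: m_def)
      then show ?thesis using p(1)[OF that] by (simp add: field_simps)
    qed
    have "m x \<in> (\<lambda>u. f x u / p u) ` \<sigma>" unfolding m_def using fin assms(3) by (intro Min_in) auto
    then obtain u0 where u0: "u0 \<in> \<sigma>" "f x u0 / p u0 = m x" by force
    have m0: "m x \<ge> 0" using u0 F V p(1)[OF u0(1)] by (metis divide_nonneg_pos subsetD)
    have mleV: "m x * p w \<le> f x w" if "w \<in> V" for w
      using mle[of w] F(1) p(2)[of w] that by (cases "w \<in> \<sigma>") auto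
    \<comment> \<open>Otherwise \<open>f x\<close> dominates \<open>p\<close> in every coordinate,
      and equal sums force \<open>f x = p\<close>, the excluded point.\<close>
    have m1: "m x < 1"
    proof (rule ccontr)
      assume "\<not> m x < 1"
      then have le: "p w \<le> f x w" if "w \<in> V" for w
      proof -
        have "0 \<le> p w" using p(1)[of w] p(2)[of w] that by (cases "w \<in> \<sigma>") auto
        then have "1 * p w \<le> m x * p w" using \<open>\<not> m x < 1\<close> by (intro mult_right_mono) auto
        then show ?thesis using mleV[OF that] by simp
      qed
      obtain w where "w \<in> V" "f x w \<noteq> p w" using miss[OF x] by blast
      then have "sum p V < sum (f x) V"
        using le V(1) by (intro sum_strict_mono_ex1) (auto simp: less_le intro: bexI[of _ w])
      then show False using F(2) p(3) by simp
    qed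
    have nonneg: "0 \<le> g x w" if "w \<in> V" for w
      using that mleV[OF that] m1 by (simp add: g_def)
    have "sum (g x) V = (sum (f x) V - m x * sum p V) / (1 - m x)"
      by (simp add: g_def sum_subtractf sum_distrib_left flip: sum_divide_distrib)
    then have sum: "sum (g x) V = 1" using F(2) p(3) m1 by simp
    have "{w \<in> V. g x w \<noteq> 0} \<in> K \<and> (\<exists>\<sigma>\<in>K'. \<forall>w\<in>V. f x w \<noteq> 0 \<or> g x w \<noteq> 0 \<longrightarrow> w \<in> \<sigma>)"
    proof (cases "m x = 0")
      case True
      then have gf: "g x w = f x w" if "w \<in> V" for w using that by (simp add: g_def)
      then have "{w \<in> V. g x w \<noteq> 0} = ?S" by auto
      moreover have "u0 \<notin> ?S" using u0 True p(1)[OF u0(1)] by auto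
      then have "?S \<in> K" using F(3) K' u0(1) by auto
      moreover have "?S \<in> K' \<and> (\<forall>w\<in>V. f x w \<noteq> 0 \<or> g x w \<noteq> 0 \<longrightarrow> w \<in> ?S)" using F(3) gf by auto
      ultimately show ?thesis by (intro conjI bexI[of _ ?S]) auto
    next
      case False
      have "\<sigma> \<subseteq> ?S"
      proof
        fix u assume u: "u \<in> \<sigma>"
        then have "0 < m x * p u" using False m0 p(1) by simp
        then show "u \<in> ?S" using mle[OF u] u V by auto
      qed
      then have "?S \<notin> K" using K down_closedD by blast
      then have S: "?S \<subseteq> \<sigma>" using F(3) K'(1) by auto
      have gS: "w \<in> \<sigma>" if "w \<in> V" "g x w \<noteq> 0" for w
      proof (rule ccontr)
        assume w: "w \<notin> \<sigma>"
        then have "f x w = 0" using S that by auto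
        then show False using w that p(2)[of w] by (simp add: g_def)
      qed
      moreover have "g x u0 = 0" using u0 p(1)[OF u0(1)] V by (auto simp: g_def field_simps)
      ultimately have "{w \<in> V. g x w \<noteq> 0} \<subset> \<sigma>" using u0(1) by auto
      then have "{w \<in> V. g x w \<noteq> 0} \<in> K" by (rule faces)
      moreover have "\<sigma> \<in> K'" by (simp add: K')
      moreover have "\<forall>w\<in>V. f x w \<noteq> 0 \<or> g x w \<noteq> 0 \<longrightarrow> w \<in> \<sigma>" using S gS by blast
      ultimately show ?thesis by blast
    qed
    then show ?thesis using nonneg sum m1 by (auto simp: topspace_geom_realization g_def)
  qed
  have gcont: "continuous_map T euclideanreal (\<lambda>x. g x w)" if "w \<in> V" for w
  proof -
    have "continuous_map T euclideanreal (\<lambda>x. (f x w - m x * p w) / (1 - m x))"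
      using main by (intro continuous_map_diff continuous_map_real_mult continuous_map_real_divide fc mc that) force+
    then show ?thesis using that by (simp add: g_def)
  qed
  then have g: "continuous_map T (geom_realization V K) g"
    using main by (simp add: continuous_map_geom_realization)
  have "K \<subseteq> K'" by (auto simp: K')
  then have "continuous_map T (geom_realization V K') g"
    using gcont main by (auto simp: continuous_map_geom_realization topspace_geom_realization)
  then have "homotopic_with (\<lambda>h. True) T (geom_realization V K') f g"
    using main by (intro homotopic_with_geom_realization_linear[OF f _ K'(2)]) auto
  then show ?thesis using g by blast
qed

text \<open>Near the barycentre of \<open>\<sigma>\<close> the map is replaced by a Lipschitz approximation \<open>g\<close> in all coordinates
  but \<open>u0\<close>, which is adjusted to keep the sum equal to 1; \<open>\<phi>\<close> is the cutoff function.\<close>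

lemma perturb_off_interior_point:
  assumes V: "finite V" "\<sigma> \<subseteq> V" and card: "card \<sigma> \<ge> t + 2" and K: "down_closed K" "\<sigma> \<notin> K"
    and K': "K' = insert \<sigma> K" "down_closed K'"
    and f: "continuous_map (nsphere t) (geom_realization V K') f"
  obtains h p where "continuous_map (nsphere t) (geom_realization V K') h"
    "homotopic_with (\<lambda>h. True) (nsphere t) (geom_realization V K') f h"
    "\<And>u. u \<in> \<sigma> \<Longrightarrow> p u > 0" "\<And>u. u \<in> V - \<sigma> \<Longrightarrow> p u = 0" "sum p V = (1::real)"
    "\<And>x. x \<in> topspace (nsphere t) \<Longrightarrow> \<exists>w\<in>V. h x w \<noteq> p w"
proof -
  let ?T = "topspace (nsphere t)"
  have fin: "finite \<sigma>" using V finite_subset by auto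
  obtain u0 where u0: "u0 \<in> \<sigma>" using card by fastforce
  define U where "U = \<sigma> - {u0}"
  define D where "D = real (card \<sigma>)"
  define b where "b = 1 / D"
  \<comment> \<open>Chosen so that \<open>10 * (D * \<epsilon>) = b\<close>. Where the cutoff is
    nonzero, coordinates in \<sigma> differ from \<open>b\<close> by less than
    \<open>8 * (D * \<epsilon>)\<close> and hence exceed \<open>2 * (D * \<epsilon>)\<close>, while
    the perturbation changes them by at most \<open>D * \<epsilon>\<close>.\<close>
  define \<epsilon> where "\<epsilon> = 1 / (10 * D\<^sup>2)"
  have U: "finite U" "card U \<ge> t + 1" "u0 \<notin> U" "\<sigma> = insert u0 U" "real (card U) = D - 1" "U \<subseteq> V" "u0 \<in> V"
    using u0 fin card V by (auto simp: U_def D_def of_nat_diff)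
  have D: "D \<ge> 2" using card by (simp add: D_def)
  have \<epsilon>: "\<epsilon> > 0" "10 * (D * \<epsilon>) = b" using D by (auto simp: \<epsilon>_def b_def power2_eq_square)
  have Db: "D * b = 1" using D by (simp add: b_def)
  have \<epsilon>D: "\<epsilon> \<le> D * \<epsilon>" using D \<epsilon>(1) by simp
  have fc: "continuous_map (nsphere t) euclideanreal (\<lambda>x. f x w)" if "w \<in> V" for w
    using f that by (simp add: continuous_map_geom_realization)
  define P where "P u g L \<longleftrightarrow> (\<forall>x\<in>?T. \<bar>f x u - g x\<bar> < \<epsilon>) \<and>
      (\<forall>x\<in>?T. \<forall>y\<in>?T. \<bar>g x - g y\<bar> \<le> L * (\<Sum>i\<le>t. \<bar>x i - y i\<bar>)) \<and>
      continuous_map (nsphere t) euclideanreal g" for u g and L :: real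
  have "\<exists>g L. P u g L" if "u \<in> U" for u
  proof -
    have "u \<in> V" using that U by auto
    from lipschitz_approximation_nsphere[OF fc[OF this] \<epsilon>(1)] show ?thesis unfolding P_def by metis
  qed
  then obtain g L where "\<And>u. u \<in> U \<Longrightarrow> P u (g u) (L u)" by metis
  then have g: "\<And>u x. u \<in> U \<Longrightarrow> x \<in> ?T \<Longrightarrow> \<bar>f x u - g u x\<bar> < \<epsilon>"
    "\<And>u x y. u \<in> U \<Longrightarrow> x \<in> ?T \<Longrightarrow> y \<in> ?T \<Longrightarrow> \<bar>g u x - g u y\<bar> \<le> L u * (\<Sum>i\<le>t. \<bar>x i - y i\<bar>)"
    "\<And>u. u \<in> U \<Longrightarrow> continuous_map (nsphere t) euclideanreal (g u)"
    by (simp_all add: P_def)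
  have lip: "\<bar>g u x - g u y\<bar> \<le> (\<Sum>u\<in>U. \<bar>L u\<bar>) * (\<Sum>i\<le>t. \<bar>x i - y i\<bar>)"
    if "u \<in> U" "x \<in> ?T" "y \<in> ?T" for u x y
  proof -
    have "\<bar>L u\<bar> \<le> (\<Sum>u\<in>U. \<bar>L u\<bar>)" using that U by (intro member_le_sum) auto
    then have "L u * (\<Sum>i\<le>t. \<bar>x i - y i\<bar>) \<le> (\<Sum>u\<in>U. \<bar>L u\<bar>) * (\<Sum>i\<le>t. \<bar>x i - y i\<bar>)"
      by (intro mult_right_mono sum_nonneg) auto
    then show ?thesis using g(2)[OF that] by linarith
  qed
  obtain q where q: "\<And>u. u \<in> U \<Longrightarrow> \<bar>q u - b\<bar> \<le> \<epsilon>" "\<And>x. x \<in> ?T \<Longrightarrow> \<exists>u\<in>U. g u x \<noteq> q u"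
    by (rule lipschitz_image_misses_point[OF U(1,2) \<epsilon>(1) lip]) blast+
  \<comment> \<open>The missed values \<open>q\<close> serve as coordinates on \<open>U\<close>; the
    coordinate at \<open>u0\<close> completes the sum to 1 and stays positive because
    \<open>q\<close> is close to \<open>b\<close>.\<close>
  define p where "p w = (if w \<in> U then q w else if w = u0 then 1 - sum q U else 0)" for w
  have p_pos: "p u > 0" if "u \<in> \<sigma>" for u
  proof (cases "u \<in> U")
    case True
    then have "p u \<ge> b - \<epsilon>" using q(1)[OF True] by (simp add: p_def abs_le_iff)
    then show ?thesis using \<epsilon> \<epsilon>D by linarith
  next
    case False
    have "q u \<le> b + \<epsilon>" if "u \<in> U" for u using q(1)[OF that] by linarith
    then have "sum q U \<le> real (card U) * (b + \<epsilon>)" by (rule sum_bounded_above)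
    also have "\<dots> = 1 - b + (D * \<epsilon> - \<epsilon>)" unfolding U(5) using Db by (simp add: algebra_simps)
    also have "\<dots> < 1" using \<epsilon> \<epsilon>D by linarith
    finally show ?thesis using False that U by (simp add: p_def)
  qed
  have p_sum: "sum p V = 1"
  proof -
    have "sum p V = sum p \<sigma>" using V U by (intro sum.mono_neutral_right) (auto simp: p_def)
    also have "\<dots> = p u0 + sum p U" using U by simp
    also have "sum p U = sum q U" by (simp add: p_def)
    finally show ?thesis using U by (simp add: p_def)
  qed
  define \<psi> where "\<psi> x = (\<Sum>u\<in>\<sigma>. \<bar>f x u - b\<bar>)" for x
  \<comment> \<open>Equal to 1 for \<open>\<psi> x \<le> 4 * (D * \<epsilon>)\<close> and to 0 for
    \<open>\<psi> x \<ge> 8 * (D * \<epsilon>)\<close>.\<close>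
  define \<phi> where "\<phi> x = max 0 (min 1 (2 - \<psi> x / (4 * (D * \<epsilon>))))" for x
  define \<delta> where "\<delta> x w = (if w \<in> U then g w x - f x w else if w = u0 then - (\<Sum>u\<in>U. g u x - f x u) else 0)" for x w
  define h where "h x = (\<lambda>w\<in>V. f x w + \<phi> x * \<delta> x w)" for x
  have \<phi>: "0 \<le> \<phi> x" "\<phi> x \<le> 1" for x by (auto simp: \<phi>_def)
  have \<phi>c: "continuous_map (nsphere t) euclideanreal \<phi>"
  proof -
    have "continuous_map (nsphere t) euclideanreal \<psi>" unfolding \<psi>_def using V fin
      by (intro continuous_map_sum continuous_map_real_abs continuous_map_diff fc) auto
    then show ?thesis unfolding \<phi>_def using \<epsilon> D
      by (intro continuous_map_real_max continuous_map_real_min continuous_map_diff continuous_map_real_divide) auto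
  qed
  have \<delta>c: "continuous_map (nsphere t) euclideanreal (\<lambda>x. \<delta> x w)" for w
  proof -
    have 1: "continuous_map (nsphere t) euclideanreal (\<lambda>x. g u x - f x u)" if "u \<in> U" for u
      using that U g(3) by (intro continuous_map_diff fc) auto
    have 2: "continuous_map (nsphere t) euclideanreal (\<lambda>x. - (\<Sum>u\<in>U. g u x - f x u))"
      using U 1 by (intro continuous_map_minus continuous_map_sum) auto
    show ?thesis using 1[of w] 2 by (cases "w \<in> U"; cases "w = u0") (auto simp: \<delta>_def)
  qed
  have \<delta>_le: "\<bar>\<delta> x w\<bar> \<le> D * \<epsilon>" if "x \<in> ?T" for x w
  proof -
    have 1: "\<bar>g u x - f x u\<bar> \<le> \<epsilon>" if "u \<in> U" for u using g(1)[OF that \<open>x \<in> ?T\<close>] by (simp add: abs_minus_commute)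
    have "\<bar>\<Sum>u\<in>U. g u x - f x u\<bar> \<le> (\<Sum>u\<in>U. \<bar>g u x - f x u\<bar>)" by (rule sum_abs)
    also have "\<dots> \<le> real (card U) * \<epsilon>" using 1 by (intro sum_bounded_above) auto
    also have "\<dots> \<le> D * \<epsilon>" using \<epsilon>(1) U(5) by (intro mult_right_mono) auto
    finally have "\<bar>- (\<Sum>u\<in>U. g u x - f x u)\<bar> \<le> D * \<epsilon>" by (simp only: abs_minus_cancel)
    moreover have "0 \<le> D * \<epsilon>" using \<epsilon> D by simp
    moreover have "\<bar>g w x - f x w\<bar> \<le> D * \<epsilon>" if "w \<in> U" using 1[OF that] \<epsilon>D by linarith
    ultimately show ?thesis using U(3) by (cases "w \<in> U"; cases "w = u0") (auto simp: \<delta>_def)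
  qed
  have \<delta>_sum: "sum (\<delta> x) V = 0" for x
  proof -
    have "sum (\<delta> x) V = sum (\<delta> x) \<sigma>" using V U by (intro sum.mono_neutral_right) (auto simp: \<delta>_def)
    also have "\<dots> = \<delta> x u0 + sum (\<delta> x) U" using U by simp
    also have "sum (\<delta> x) U = (\<Sum>u\<in>U. g u x - f x u)" by (simp add: \<delta>_def)
    finally show ?thesis using U by (simp add: \<delta>_def)
  qed
  have F: "\<forall>w\<in>V. 0 \<le> f x w" "sum (f x) V = 1" "{w\<in>V. f x w \<noteq> 0} \<in> K'" if "x \<in> ?T" for x
    using f that by (auto simp: continuous_map_geom_realization topspace_geom_realization)
  have supp: "{w\<in>V. f x w \<noteq> 0} = \<sigma>" if "x \<in> ?T" "\<And>u. u \<in> \<sigma> \<Longrightarrow> f x u \<noteq> 0" for x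
  proof -
    have "\<sigma> \<subseteq> {w\<in>V. f x w \<noteq> 0}" using that V by auto
    then have "{w\<in>V. f x w \<noteq> 0} \<notin> K" using K down_closedD by blast
    then show ?thesis using F(3)[OF that(1)] K' by auto
  qed
  have near: "f x u > D * \<epsilon>" if "\<phi> x \<noteq> 0" "u \<in> \<sigma>" for x u
  proof -
    have De: "0 < 4 * (D * \<epsilon>)" using \<epsilon> D by simp
    have "\<psi> x / (4 * (D * \<epsilon>)) < 2" using that(1) by (auto simp: \<phi>_def max_def min_def split: if_splits)
    then have "\<psi> x < 8 * (D * \<epsilon>)" using De by (simp add: pos_divide_less_eq)
    moreover have "\<bar>f x u - b\<bar> \<le> \<psi> x" unfolding \<psi>_def using that fin by (intro member_le_sum) auto
    ultimately show ?thesis using \<epsilon>(2) De by linarith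
  qed
  have hext: "h x \<in> extensional V" for x by (simp add: h_def)
  have h_mem: "h x \<in> topspace (geom_realization V K') \<and> (\<exists>\<rho>\<in>K'. \<forall>w\<in>V. f x w \<noteq> 0 \<or> h x w \<noteq> 0 \<longrightarrow> w \<in> \<rho>)"
    if x: "x \<in> ?T" for x
  proof (cases "\<phi> x = 0")
    case True
    then have hf: "h x w = f x w" if "w \<in> V" for w using that by (simp add: h_def)
    have "{w\<in>V. h x w \<noteq> 0} = {w\<in>V. f x w \<noteq> 0}" using hf by auto
    moreover have "sum (h x) V = sum (f x) V" using hf by (intro sum.cong) auto
    moreover have "\<forall>w\<in>V. f x w \<noteq> 0 \<or> h x w \<noteq> 0 \<longrightarrow> w \<in> {w\<in>V. f x w \<noteq> 0}" using hf by auto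
    ultimately show ?thesis using F[OF x] hf hext
      by (intro conjI bexI[of _ "{w\<in>V. f x w \<noteq> 0}"]) (simp_all add: topspace_geom_realization)
  next
    case False
    have De: "0 < D * \<epsilon>" using \<epsilon> D by simp
    have S: "{w\<in>V. f x w \<noteq> 0} = \<sigma>" using near[OF False] De by (intro supp[OF x]) force
    have pos: "h x u > 0" if "u \<in> \<sigma>" for u
    proof -
      have "\<bar>\<phi> x * \<delta> x u\<bar> \<le> 1 * (D * \<epsilon>)"
        unfolding abs_mult using \<phi>[of x] \<delta>_le[OF x] by (intro mult_mono) auto
      then show ?thesis using near[OF False that] that V by (auto simp: h_def abs_le_iff)
    qed
    have zero: "h x w = 0" if "w \<in> V - \<sigma>" for w
      using that S U by (auto simp: h_def \<delta>_def)
    have Sh: "{w\<in>V. h x w \<noteq> 0} = \<sigma>" using pos zero V by force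
    have "0 \<le> h x w" if "w \<in> V" for w using pos[of w] zero[of w] that by (cases "w \<in> \<sigma>") auto
    moreover have "sum (h x) V = 1"
      using F(2)[OF x] \<delta>_sum by (simp add: h_def sum.distrib flip: sum_distrib_left)
    moreover have "\<forall>w\<in>V. f x w \<noteq> 0 \<or> h x w \<noteq> 0 \<longrightarrow> w \<in> \<sigma>" using S Sh by blast
    ultimately show ?thesis using Sh K'(1) hext
      by (intro conjI bexI[of _ \<sigma>]) (simp_all add: topspace_geom_realization)
  qed
  have "continuous_map (nsphere t) euclideanreal (\<lambda>x. h x w)" if "w \<in> V" for w
  proof -
    have "continuous_map (nsphere t) euclideanreal (\<lambda>x. f x w + \<phi> x * \<delta> x w)"
      by (intro continuous_map_add continuous_map_real_mult fc \<phi>c \<delta>c that)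
    then show ?thesis using that by (simp add: h_def)
  qed
  then have h: "continuous_map (nsphere t) (geom_realization V K') h"
    using h_mem by (simp add: continuous_map_geom_realization)
  have hom: "homotopic_with (\<lambda>h. True) (nsphere t) (geom_realization V K') f h"
    using h_mem by (intro homotopic_with_geom_realization_linear[OF f h K'(2)]) auto
  \<comment> \<open>If \<open>h x = p\<close>, then \<open>f x\<close> is within
    \<open>2 * \<epsilon>\<close> of \<open>b\<close> on \<open>U\<close>, and the sum condition
    controls \<open>u0\<close>. This places \<open>x\<close> where the cutoff is 1, so
    \<open>h x\<close> coincides with the Lipschitz approximation on \<open>U\<close>, which misses
    \<open>q\<close>.\<close>
  have miss: "\<exists>w\<in>V. h x w \<noteq> p w" if x: "x \<in> ?T" for x
  proof (rule ccontr)
    assume "\<not> ?thesis"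
    then have hp: "h x w = p w" if "w \<in> V" for w using that by blast
    have De: "0 < D * \<epsilon>" using \<epsilon> D by simp
    have "f x u \<noteq> 0" if u: "u \<in> \<sigma>" for u
    proof (cases "\<phi> x = 0")
      case True
      then have "f x u = p u" using hp[of u] u V by (auto simp: h_def)
      then show ?thesis using p_pos[OF u] by simp
    next
      case False
      then show ?thesis using near[OF False u] De by linarith
    qed
    then have S: "{w\<in>V. f x w \<noteq> 0} = \<sigma>" by (rule supp[OF x])
    have dU: "\<bar>f x u - b\<bar> \<le> 2 * \<epsilon>" if u: "u \<in> U" for u
    proof -
      have "f x u + \<phi> x * (g u x - f x u) = q u"
        using hp[of u] u U by (auto simp: h_def \<delta>_def p_def)
      moreover have "\<bar>\<phi> x * (g u x - f x u)\<bar> \<le> 1 * \<epsilon>"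
        unfolding abs_mult using \<phi>[of x] g(1)[OF u x] by (intro mult_mono) (auto simp: abs_minus_commute)
      ultimately show ?thesis using q(1)[OF u] by linarith
    qed
    have "sum (f x) \<sigma> = sum (f x) V" using V S by (intro sum.mono_neutral_left) auto
    then have "f x u0 + sum (f x) U = 1" using F(2)[OF x] U by simp
    moreover have "(\<Sum>u\<in>U. f x u - b) = sum (f x) U - (1 - b)"
      using Db by (simp add: sum_subtractf U(5) algebra_simps)
    ultimately have "f x u0 - b = - (\<Sum>u\<in>U. f x u - b)" by simp
    then have "\<bar>f x u0 - b\<bar> \<le> (\<Sum>u\<in>U. \<bar>f x u - b\<bar>)" by (simp only: abs_minus_cancel sum_abs)
    moreover have "(\<Sum>u\<in>U. \<bar>f x u - b\<bar>) \<le> real (card U) * (2 * \<epsilon>)" using dU by (intro sum_bounded_above) auto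
    moreover have "real (card U) * (2 * \<epsilon>) \<le> 2 * (D * \<epsilon>)" using U(5) \<epsilon>(1) by (simp add: algebra_simps)
    moreover have "\<psi> x = \<bar>f x u0 - b\<bar> + (\<Sum>u\<in>U. \<bar>f x u - b\<bar>)" using U by (simp add: \<psi>_def)
    ultimately have "\<psi> x \<le> 4 * (D * \<epsilon>)" by linarith
    then have "\<psi> x / (4 * (D * \<epsilon>)) \<le> 1" using De by simp
    then have "\<phi> x = 1" by (simp add: \<phi>_def)
    then have "g u x = q u" if "u \<in> U" for u
      using hp[of u] that U by (auto simp: h_def \<delta>_def p_def)
    then show False using q(2)[OF x] by blast
  qed
  show thesis
    using that[OF h hom, of p] p_pos p_sum miss U(4) by (auto simp: p_def)
qed

text \<open>The start of every nonvoid construction with \<open>s \<ge> 1\<close>. The empty simplex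
  contributes no point, as coordinates sum to 1.\<close>

lemma c_connected_point:
  assumes "finite V" "v \<in> V"
  shows "c_connected c (geom_realization V {{}, {v}})"
proof -
  let ?X = "geom_realization V {{}, {v}}"
  define e where "e = (\<lambda>w\<in>V. if w = v then 1 else 0 :: real)"
  have "{w \<in> V. e w \<noteq> 0} = {v}" using assms by (auto simp: e_def)
  then have e: "e \<in> topspace ?X" using assms by (auto simp: topspace_geom_realization e_def)
  have "x = e" if "x \<in> topspace ?X" for x
  proof -
    have x: "x \<in> extensional V" "sum x V = 1" "{w \<in> V. x w \<noteq> 0} \<in> {{}, {v}}"
      using that by (auto simp: topspace_geom_realization)
    have z: "x w = 0" if "w \<in> V - {v}" for w using that x(3) by auto
    have "sum x V = x v + sum x (V - {v})" using assms by (rule sum.remove)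
    also have "sum x (V - {v}) = 0" using z by (intro sum.neutral) auto
    finally have "x v = 1" using x(2) by simp
    then show ?thesis using z x(1) by (auto simp: e_def fun_eq_iff extensional_def)
  qed
  then have "homotopic_with (\<lambda>h. True) (nsphere t) ?X f (\<lambda>x. e)" if "continuous_map (nsphere t) ?X f" for t f
    using that by (intro homotopic_with_equal) (auto simp: continuous_map_geom_realization)
  then show ?thesis using e unfolding c_connected_def by blast
qed

text \<open>For \<open>t \<le> s - 2\<close> a critical simplex has at least \<open>t + 2\<close>
  vertices, so its dimension exceeds that of the sphere and the map can be pushed off its
  interior.\<close>

lemma c_connected_morse_built:
  assumes "morse_built s K" "finite V" "K \<subseteq> Pow V" "s \<ge> 1" "K \<noteq> {}"
  shows "c_connected (int s - 2) (geom_realization V K)"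
  using assms
proof (induction rule: morse_built.induct)
  case void
  then show ?case by simp
next
  case (attach K \<sigma>)
  \<comment> \<open>Here \<open>s \<ge> 1\<close> matters: attaching the empty simplex would yield
    \<open>{{}}\<close>, whose realization is empty.\<close>
  have "\<sigma> \<noteq> {}" using attach by auto
  then have "K \<noteq> {}" using attach.hyps(4)[of "{}"] by auto
  then have IH: "c_connected (int s - 2) (geom_realization V K)" using attach by auto
  have dc: "down_closed K" "down_closed (insert \<sigma> K)"
    using morse_built.attach[OF attach.hyps] attach.hyps(1) by (auto intro: down_closed_morse_built)
  show ?case
  proof (rule c_connected_geom_realization_mono[OF IH])
    fix t f assume t: "int t \<le> int s - 2" and f: "continuous_map (nsphere t) (geom_realization V (insert \<sigma> K)) f"
    have \<sigma>: "card \<sigma> \<ge> t + 2" "\<sigma> \<subseteq> V" using t attach by auto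
    obtain h p where h: "continuous_map (nsphere t) (geom_realization V (insert \<sigma> K)) h"
      "homotopic_with (\<lambda>h. True) (nsphere t) (geom_realization V (insert \<sigma> K)) f h"
      "\<And>u. u \<in> \<sigma> \<Longrightarrow> p u > 0" "\<And>u. u \<in> V - \<sigma> \<Longrightarrow> p u = 0" "sum p V = (1::real)"
      "\<And>x. x \<in> topspace (nsphere t) \<Longrightarrow> \<exists>w\<in>V. h x w \<noteq> p w"
      by (rule perturb_off_interior_point[OF attach.prems(1) \<sigma>(2,1) dc(1) attach.hyps(3) refl dc(2) f]) blast
    obtain g where "continuous_map (nsphere t) (geom_realization V K) g"
      "homotopic_with (\<lambda>h. True) (nsphere t) (geom_realization V (insert \<sigma> K)) h g"
      using radial_projection[OF attach.prems(1) \<sigma>(2) \<open>\<sigma> \<noteq> {}\<close> dc(1) attach.hyps(3) refl dc(2) attach.hyps(4) h(1,3-6)]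
      by blast
    then show "\<exists>g. continuous_map (nsphere t) (geom_realization V K) g \<and>
        homotopic_with (\<lambda>h. True) (nsphere t) (geom_realization V (insert \<sigma> K)) f g"
      using h(2) homotopic_with_trans by blast
  qed (use attach.prems in auto)
next
  case (expand K \<tau> v)
  have dc: "down_closed K" "down_closed (insert \<tau> (insert (insert v \<tau>) K))"
    using morse_built.expand[OF expand.hyps] expand.hyps(1) by (auto intro: down_closed_morse_built)
  have vV: "insert v \<tau> \<subseteq> V" using expand.prems by auto
  show ?case
  proof (cases "\<tau> = {}")
    case True
    then have "K = {}" using expand.hyps(4) dc(1) down_closedD by blast
    then show ?thesis using True c_connected_point[OF expand.prems(1), of v] vV by simp
  next
    case False
    then have "{} \<in> K" using expand.hyps(5)[of "{}"] by auto
    then have IH: "c_connected (int s - 2) (geom_realization V K)" using expand by auto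
    show ?thesis
      using expand.prems expansion_retraction[OF expand.prems(1) vV expand.hyps(3) False dc(1) expand.hyps(4) refl dc(2) expand.hyps(5)]
      by (intro c_connected_geom_realization_mono[OF IH]) auto
  qed
qed

theorem theorem6p1:
  fixes n m :: nat and k l :: "nat \<Rightarrow> nat"
  assumes "n \<ge> 1" and "m \<ge> 1"
    and "(\<Sum>j=1..m. l j) \<ge> (\<Sum>i=1..n. k i) + n - 1"
  shows "c_connected (int (\<Sum>i=1..n. k i) - 2) (geom_realization (board n m) (rook_complex n m k l))"
proof -
  \<comment> \<open>Rows and columns outside the board carry no rooks, so bounding them as well
    changes nothing.\<close>
  have eq: "rook_complex n m k l = rooks ({1..n} \<times> {1..m}) k l"
  proof -
    have "card {j. (i, j) \<in> \<sigma>} = 0" if "\<sigma> \<subseteq> {1..n} \<times> {1..m}" "i \<notin> {1..n}" for \<sigma> i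
    proof -
      have "{j. (i, j) \<in> \<sigma>} = {}" using that by auto
      then show ?thesis by simp
    qed
    moreover have "card {i. (i, j) \<in> \<sigma>} = 0" if "\<sigma> \<subseteq> {1..n} \<times> {1..m}" "j \<notin> {1..m}" for \<sigma> j
    proof -
      have "{i. (i, j) \<in> \<sigma>} = {}" using that by auto
      then show ?thesis by simp
    qed
    ultimately show ?thesis unfolding rook_complex_def rooks_def board_def
      by (intro Collect_cong) (metis le0)
  qed
  show ?thesis
  proof (cases "(\<Sum>i=1..n. k i) = 0")
    \<comment> \<open>Without rooks the claim is (-2)-connectedness, which holds by
      convention.\<close>
    case True
    then show ?thesis by (simp add: c_connected_def)
  next
    case False
    have "morse_built (\<Sum>i=1..n. k i) (rooks ({1..n} \<times> {1..m}) k l)"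
      using assms by (intro morse_built_rooks) auto
    moreover have "{} \<in> rooks ({1..n} \<times> {1..m}) k l" by (simp add: rooks_def)
    moreover have "rooks ({1..n} \<times> {1..m}) k l \<subseteq> Pow (board n m)" by (auto simp: rooks_def board_def)
    moreover have "finite (board n m)" by (simp add: board_def)
    moreover have "(\<Sum>i=1..n. k i) \<ge> 1" using False by linarith
    ultimately show ?thesis unfolding eq by (intro c_connected_morse_built) blast+
  qed
qed

end
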